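(* Let $\mathcal R$ be the compositum of all real quadratic integer rings $\mathcal O_{\mathbb{Q}(\sqrt{d})}$ with $d>1$ squarefree. Let $A$ be an indecomposable cyclotomic matrix with entries in $\mathcal R$. Then $A$ is a symmetric matrix over one of the rings $\mathbb{Z}$, $\mathbb{Z}[\sqrt{2}]$, $\mathbb{Z}[\varphi]$, or $\mathbb{Z}[\sqrt{3}]$, where $\varphi=\frac12+\frac{\sqrt5}{2}$.
   Context: A real symmetric matrix $A$ is cyclotomic if its characteristic polynomial $\det(xI-A)$ has integer coefficients and all its eigenvalues lie in $[-2,2]$. A square matrix $A=(a_{uv})$ is indecomposable if its underlying graph (vertices $u\neq v$ adjacent iff $a_{uv}\neq 0$) is connected. *)

theory Defs
  imports "Jordan_Normal_Form.Char_Poly" "HOL-Computational_Algebra.Squarefree"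
begin

definition alg_int :: "real \<Rightarrow> bool" where
  "alg_int x \<longleftrightarrow> (\<exists>p :: int poly. lead_coeff p = 1 \<and> poly (map_poly of_int p) x = 0)"

definition quad_field :: "int \<Rightarrow> real set" where
  "quad_field d = {of_rat a + of_rat b * sqrt (of_int d) | a b. True}"

definition quad_int_ring :: "int \<Rightarrow> real set" where
  "quad_int_ring d = {x \<in> quad_field d. alg_int x}"

inductive_set quad_compositum :: "real set" where
  gen: "d > 1 \<Longrightarrow> squarefree d \<Longrightarrow> x \<in> quad_int_ring d \<Longrightarrow> x \<in> quad_compositum"
| one: "1 \<in> quad_compositum"
| neg: "x \<in> quad_compositum \<Longrightarrow> - x \<in> quad_compositum"
| add: "x \<in> quad_compositum \<Longrightarrow> y \<in> quad_compositum \<Longrightarrow> x + y \<in> quad_compositum"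
| mult: "x \<in> quad_compositum \<Longrightarrow> y \<in> quad_compositum \<Longrightarrow> x * y \<in> quad_compositum"

definition cyclotomic_mat :: "real mat \<Rightarrow> bool" where
  "cyclotomic_mat A \<longleftrightarrow>
     dim_row A = dim_col A \<and> transpose_mat A = A \<and>
     (\<forall>i. coeff (char_poly A) i \<in> \<int>) \<and>
     (\<forall>k :: complex. eigenvalue (map_mat complex_of_real A) k \<longrightarrow>
        (\<exists>r :: real. -2 \<le> r \<and> r \<le> 2 \<and> k = complex_of_real r))"

definition mat_adj :: "'a :: zero mat \<Rightarrow> nat \<Rightarrow> nat \<Rightarrow> bool" where
  "mat_adj A u v \<longleftrightarrow> u < dim_row A \<and> v < dim_row A \<and> u \<noteq> v \<and> A $$ (u, v) \<noteq> 0"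

definition indecomposable :: "'a :: zero mat \<Rightarrow> bool" where
  "indecomposable A \<longleftrightarrow> (\<forall>u < dim_row A. \<forall>v < dim_row A. (mat_adj A)\<^sup>*\<^sup>* u v)"

definition Z_sqrt2 :: "real set" where
  "Z_sqrt2 = {of_int a + of_int b * sqrt 2 | a b. True}"

definition golden :: real where
  "golden = 1/2 + sqrt 5 / 2"

definition Z_golden :: "real set" where
  "Z_golden = {of_int a + of_int b * golden | a b. True}"

definition Z_sqrt3 :: "real set" where
  "Z_sqrt3 = {of_int a + of_int b * sqrt 3 | a b. True}"

end

theory Submission
  imports Defs "Jordan_Normal_Form.Spectral_Radius"
begin

text \<open>
  Conjugating the entries of a cyclotomic matrix by a homomorphism \<open>\<sigma>\<close> of the field they generate
  fixes the characteristic polynomial, so every conjugate is again cyclotomic and all conjugates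
  of an entry \<open>a\<close> lie in [-2, 2]. In the compositum one has \<open>x ^ 8 \<equiv> x ^ 2\<close> mod 2 and
  \<open>x ^ 27 \<equiv> x ^ 3\<close> mod 3, because its generators satisfy monic integral quadratic equations.
  Lifted along the maps \<open>2 cos t \<mapsto> 2 cos 2t\<close> and \<open>2 cos t \<mapsto> 2 cos 3t\<close> these become congruences
  modulo 8 and 9 between numbers with all conjugates in [-2, 2], hence equalities. They leave only
  the numbers \<open>0, \<plusminus>1, \<plusminus>2, \<plusminus>sqrt 2, \<plusminus>sqrt 3, \<plusminus>\<phi>, \<plusminus>(1 - \<phi>)\<close> for \<open>a\<close>.

  If irrational entries of two different types occurred, a shortest walk between them would,
  after a suitable conjugation, give a path with edge weights at least \<open>sqrt 2, 1, ..., 1, sqrt 2\<close>,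
  one end being strictly heavier. Its norm exceeds 2, which contradicts that all eigenvalues
  of the symmetric matrix lie in [-2, 2].
\<close>

section \<open>Algebraic integers form a ring\<close>

text \<open>Two numbers with all conjugates in [-2, 2] differ by a number with all conjugates of
  size at most 4, so a congruence forces equality only for a modulus above 4. The ring supplies
  moduli 2 and 3, hence the lifting: two doublings reach 8, one tripling reaches 9. Each prime alone
  leaves a surplus: 2 admits angles of order dividing 24 or 40, 3 those of order dividing 72 or 90;
  together they leave 24 and 10. The obstacle is 2 cos (pi/12) = (sqrt 2 + sqrt 6) / 2, an algebraic
  integer in the field of sqrt 2 and sqrt 3 that satisfies both resulting equalities. It is removed
  because it is not in the ring generated by the quadratic integers, which the congruence modulo 2
  detects. Galois theory is replaced by finite towers of real square roots, whose homomorphisms are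
  built one root at a time. Of the values sqrt 2, sqrt 3, \<phi> the smallest is sqrt 2, and a path
  with weights sqrt 2, 1, ..., 1, sqrt 2 has norm exactly 2, so two different types are just enough
  to exceed it. Conjugation comes first because 1 - \<phi> has absolute value below 1.\<close>

lemma alg_int_iff_algebraic_int: "alg_int x \<longleftrightarrow> algebraic_int x"
  unfolding alg_int_def algebraic_int_altdef_ipoly by blast

lemma alg_int_rat_imp_int: "alg_int x \<Longrightarrow> x \<in> \<rat> \<Longrightarrow> x \<in> \<int>"
  unfolding alg_int_iff_algebraic_int by (rule rational_algebraic_int_is_int)

lemma alg_int_of_int [simp]: "alg_int (of_int k)"
  unfolding alg_int_iff_algebraic_int by (rule int_imp_algebraic_int) simp

text \<open>The \<open>e i\<close> span a finitely generated subgroup that is stable under multiplication by \<open>x\<close>;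
  \<open>B\<close> is the matrix of that multiplication. Products of two such families serve sums and products.\<close>

definition int_stable :: "real \<Rightarrow> 'i set \<Rightarrow> ('i \<Rightarrow> real) \<Rightarrow> ('i \<Rightarrow> 'i \<Rightarrow> int) \<Rightarrow> bool" where
  "int_stable x I e B \<longleftrightarrow> finite I \<and> (\<exists>i\<in>I. e i \<noteq> 0) \<and>
     (\<forall>i\<in>I. x * e i = (\<Sum>k\<in>I. of_int (B i k) * e k))"

lemma alg_int_imp_int_stable:
  assumes "alg_int x"
  obtains n B where "int_stable x {..<n::nat} (\<lambda>i. x ^ i) B"
proof -
  obtain p :: "int poly" where p: "lead_coeff p = 1" "poly (map_poly of_int p) x = 0"
    using assms unfolding alg_int_def by blast
  define n where "n = degree p"
  have eq: "(\<Sum>i\<le>n. of_int (coeff p i) * x ^ i) = 0"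
    using p(2) unfolding poly_altdef n_def by (simp add: degree_map_poly coeff_map_poly)
  \<comment> \<open>A constant monic polynomial is 1 and has no root. Positive degree puts
    \<open>x ^ 0 = 1\<close> into the family, which is therefore not identically zero.\<close>
  have n0: "n \<noteq> 0"
  proof
    assume "n = 0" with eq p(1) show False unfolding n_def by simp
  qed
  have xn: "x ^ n = (\<Sum>k<n. of_int (- coeff p k) * x ^ k)"
    using eq p(1) unfolding lessThan_Suc_atMost[symmetric] n_def
    by (simp add: sum_negf)
  \<comment> \<open>Companion matrix of \<open>p\<close>: a shift, except that the last row rewrites
    \<open>x ^ n\<close> by means of \<open>p\<close>.\<close>
  define B where "B = (\<lambda>i k. if Suc i = n then - coeff p k else if k = Suc i then 1 else 0 :: int)"
  have "x * x ^ i = (\<Sum>k<n. of_int (B i k) * x ^ k)" if "i < n" for i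
  proof (cases "Suc i = n")
    case True
    then have "x * x ^ i = x ^ n" by auto
    then show ?thesis using xn True unfolding B_def by simp
  next
    case False
    then have "Suc i < n" using that by simp
    then have "(\<Sum>k<n. of_int (B i k) * x ^ k) = (\<Sum>k<n. if k = Suc i then x ^ Suc i else 0)"
      unfolding B_def by (intro sum.cong) auto
    also have "\<dots> = x ^ Suc i" using \<open>Suc i < n\<close> by simp
    finally show ?thesis by simp
  qed
  moreover have "\<exists>i\<in>{..<n}. x ^ i \<noteq> 0" using n0 by (intro bexI[of _ 0]) auto
  ultimately have "int_stable x {..<n} (\<lambda>i. x ^ i) B" unfolding int_stable_def by auto
  then show ?thesis by (rule that)
qed

text \<open>The vector of the \<open>e i\<close> is a nonzero eigenvector of the integer matrix
  \<open>B\<close> for the eigenvalue \<open>x\<close>, so \<open>x\<close> is a root of its monic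
  characteristic polynomial.\<close>

lemma int_stable_imp_alg_int:
  fixes I :: "'i set"
  assumes "int_stable x I e B"
  shows "alg_int x"
proof -
  have fin: "finite I" using assms unfolding int_stable_def by blast
  define n where "n = card I"
  obtain h where h: "bij_betw h {0..<n} I"
    using ex_bij_betw_nat_finite[OF fin] unfolding n_def by blast
  define M where "M = mat n n (\<lambda>(i, k). B (h i) (h k))"
  define v where "v = vec n (\<lambda>i. e (h i))"
  have M: "M \<in> carrier_mat n n" and v: "v \<in> carrier_vec n" unfolding M_def v_def by auto
  obtain i where i: "i \<in> I" "e i \<noteq> 0" using assms unfolding int_stable_def by blast
  then obtain j where j: "j < n" "h j = i" using h unfolding bij_betw_def by auto
  have "v \<noteq> 0\<^sub>v n"
  proof
    assume "v = 0\<^sub>v n"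
    then have "v $ j = 0" using j by simp
    then show False using j i unfolding v_def by simp
  qed
  moreover have "map_mat of_int M *\<^sub>v v = x \<cdot>\<^sub>v v"
  proof (rule eq_vecI)
    fix i assume "i < dim_vec (x \<cdot>\<^sub>v v)"
    then have i: "i < n" unfolding v_def by simp
    then have hi: "h i \<in> I" using h unfolding bij_betw_def by auto
    have "(map_mat of_int M *\<^sub>v v) $ i = (\<Sum>k\<in>{0..<n}. of_int (B (h i) (h k)) * e (h k))"
      using i unfolding M_def v_def by (simp add: scalar_prod_def)
    also have "\<dots> = (\<Sum>k\<in>I. of_int (B (h i) k) * e k)"
      by (rule sum.reindex_bij_betw[OF h])
    also have "\<dots> = x * e (h i)" using assms hi unfolding int_stable_def by simp
    finally show "(map_mat of_int M *\<^sub>v v) $ i = (x \<cdot>\<^sub>v v) $ i" using i unfolding v_def by simp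
  qed (auto simp: M_def v_def)
  ultimately have "eigenvalue (map_mat real_of_int M) x"
    using M v unfolding eigenvalue_def eigenvector_def by auto
  then have "poly (char_poly (map_mat real_of_int M)) x = 0"
    using eigenvalue_root_char_poly[of "map_mat real_of_int M" n x] M by auto
  moreover have "char_poly (map_mat real_of_int M) = map_poly of_int (char_poly M)"
    by (rule of_int_hom.char_poly_hom[OF M])
  moreover have "lead_coeff (char_poly M) = 1"
    using degree_monic_char_poly[OF M] by simp
  ultimately show ?thesis unfolding alg_int_def by (intro exI[of _ "char_poly M"]) simp
qed

text \<open>Kronecker products act on the family of products: B x 1 + 1 x C is the matrix for the
  sum and B x C the one for the product.\<close>

lemma int_stable_add_mult:
  fixes I :: "'i set" and J :: "'j set"
  assumes "int_stable x I e B" "int_stable y J f C"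
  shows "\<exists>D. int_stable (x + y) (I \<times> J) (\<lambda>(i, j). e i * f j) D"
    and "\<exists>D. int_stable (x * y) (I \<times> J) (\<lambda>(i, j). e i * f j) D"
proof -
  have fin: "finite I" "finite J" using assms unfolding int_stable_def by auto
  have nz: "\<exists>z\<in>I \<times> J. (\<lambda>(i, j). e i * f j) z \<noteq> 0"
    using assms unfolding int_stable_def by fastforce
  have ex: "x * e i = (\<Sum>k\<in>I. of_int (B i k) * e k)" if "i \<in> I" for i
    using assms(1) that unfolding int_stable_def by blast
  have fy: "y * f j = (\<Sum>k\<in>J. of_int (C j k) * f k)" if "j \<in> J" for j
    using assms(2) that unfolding int_stable_def by blast
  have pr: "(\<Sum>z\<in>I \<times> J. g (fst z) * h (snd z)) = (\<Sum>k\<in>I. g k) * (\<Sum>l\<in>J. h l)" for g h :: "_ \<Rightarrow> real"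
    unfolding sum_product sum.cartesian_product by (simp add: case_prod_beta)
  have m: "x * y * (e i * f j) = (\<Sum>z\<in>I \<times> J. of_int (B i (fst z) * C j (snd z)) * (e (fst z) * f (snd z)))"
    if "i \<in> I" "j \<in> J" for i j
    using pr[of "\<lambda>k. of_int (B i k) * e k" "\<lambda>l. of_int (C j l) * f l"]
    unfolding ex[OF that(1), symmetric] fy[OF that(2), symmetric] by (simp add: mult_ac)
  \<comment> \<open>Identity matrices, the factors 1 in B x 1 + 1 x C.\<close>
  define \<delta> where "\<delta> = (\<lambda>(a::'i) b. if a = b then 1 else 0 :: int)"
  define \<delta>' where "\<delta>' = (\<lambda>(a::'j) b. if a = b then 1 else 0 :: int)"
  have e1: "e i = (\<Sum>k\<in>I. of_int (\<delta> i k) * e k)" if "i \<in> I" for i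
  proof -
    have "(\<Sum>k\<in>I. of_int (\<delta> i k) * e k) = (\<Sum>k\<in>I. if k = i then e k else 0)"
      unfolding \<delta>_def by (intro sum.cong) auto
    then show ?thesis using that fin by simp
  qed
  have f1: "f j = (\<Sum>k\<in>J. of_int (\<delta>' j k) * f k)" if "j \<in> J" for j
  proof -
    have "(\<Sum>k\<in>J. of_int (\<delta>' j k) * f k) = (\<Sum>k\<in>J. if k = j then f k else 0)"
      unfolding \<delta>'_def by (intro sum.cong) auto
    then show ?thesis using that fin by simp
  qed
  have a: "(x + y) * (e i * f j) =
      (\<Sum>z\<in>I \<times> J. of_int (B i (fst z) * \<delta>' j (snd z) + \<delta> i (fst z) * C j (snd z)) * (e (fst z) * f (snd z)))"
    if "i \<in> I" "j \<in> J" for i j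
  proof -
    have "(x + y) * (e i * f j) = (x * e i) * f j + e i * (y * f j)" by (simp add: algebra_simps)
    also have "\<dots> = (\<Sum>z\<in>I \<times> J. (of_int (B i (fst z)) * e (fst z)) * (of_int (\<delta>' j (snd z)) * f (snd z)))
        + (\<Sum>z\<in>I \<times> J. (of_int (\<delta> i (fst z)) * e (fst z)) * (of_int (C j (snd z)) * f (snd z)))"
      using pr[of "\<lambda>k. of_int (B i k) * e k" "\<lambda>l. of_int (\<delta>' j l) * f l"]
        pr[of "\<lambda>k. of_int (\<delta> i k) * e k" "\<lambda>l. of_int (C j l) * f l"]
      unfolding ex[OF that(1), symmetric] fy[OF that(2), symmetric] e1[OF that(1), symmetric]
        f1[OF that(2), symmetric] by simp
    finally show ?thesis unfolding sum.distrib[symmetric] by (simp add: algebra_simps)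
  qed
  show "\<exists>D. int_stable (x + y) (I \<times> J) (\<lambda>(i, j). e i * f j) D"
    by (rule exI[of _ "\<lambda>(i, j) (k, l). B i k * \<delta>' j l + \<delta> i k * C j l"])
      (use a nz fin in \<open>auto simp: int_stable_def case_prod_beta\<close>)
  show "\<exists>D. int_stable (x * y) (I \<times> J) (\<lambda>(i, j). e i * f j) D"
    by (rule exI[of _ "\<lambda>(i, j) (k, l). B i k * C j l"])
      (use m nz fin in \<open>auto simp: int_stable_def case_prod_beta\<close>)
qed

lemma alg_int_add: "alg_int x \<Longrightarrow> alg_int y \<Longrightarrow> alg_int (x + y)"
  by (metis alg_int_imp_int_stable int_stable_add_mult(1) int_stable_imp_alg_int)

lemma alg_int_mult: "alg_int x \<Longrightarrow> alg_int y \<Longrightarrow> alg_int (x * y)"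
  by (metis alg_int_imp_int_stable int_stable_add_mult(2) int_stable_imp_alg_int)

lemma alg_int_minus: "alg_int x \<Longrightarrow> alg_int (- x)"
  unfolding alg_int_iff_algebraic_int by simp

lemma quad_compositum_alg_int: "x \<in> quad_compositum \<Longrightarrow> alg_int x"
  by (induction rule: quad_compositum.induct)
    (use alg_int_of_int[of 1] in \<open>auto simp: quad_int_ring_def intro: alg_int_add alg_int_mult alg_int_minus\<close>)

section \<open>Towers of real quadratic extensions\<close>

definition real_subfield :: "real set \<Rightarrow> bool" where
  "real_subfield F \<longleftrightarrow> 0 \<in> F \<and> 1 \<in> F \<and> (\<forall>x\<in>F. - x \<in> F \<and> inverse x \<in> F) \<and>
     (\<forall>x\<in>F. \<forall>y\<in>F. x + y \<in> F \<and> x * y \<in> F)"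

lemma real_subfield_closed:
  assumes "real_subfield F"
  shows "0 \<in> F" "1 \<in> F" "x \<in> F \<Longrightarrow> - x \<in> F" "x \<in> F \<Longrightarrow> inverse x \<in> F"
    "x \<in> F \<Longrightarrow> y \<in> F \<Longrightarrow> x + y \<in> F" "x \<in> F \<Longrightarrow> y \<in> F \<Longrightarrow> x * y \<in> F"
    "x \<in> F \<Longrightarrow> y \<in> F \<Longrightarrow> x - y \<in> F" "x \<in> F \<Longrightarrow> y \<in> F \<Longrightarrow> x / y \<in> F"
proof -
  show 1: "0 \<in> F" "1 \<in> F" "x \<in> F \<Longrightarrow> - x \<in> F" "x \<in> F \<Longrightarrow> inverse x \<in> F"
    "x \<in> F \<Longrightarrow> y \<in> F \<Longrightarrow> x + y \<in> F" "x \<in> F \<Longrightarrow> y \<in> F \<Longrightarrow> x * y \<in> F" for x y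
    using assms unfolding real_subfield_def by blast+
  show "x \<in> F \<Longrightarrow> y \<in> F \<Longrightarrow> x - y \<in> F" "x \<in> F \<Longrightarrow> y \<in> F \<Longrightarrow> x / y \<in> F"
    using 1(5)[of x "- y"] 1(3)[of y] 1(6)[of x "inverse y"] 1(4)[of y] by (simp_all add: divide_inverse)
qed

lemma real_subfield_of_int:
  assumes "real_subfield F" shows "of_int k \<in> F"
proof -
  have n: "of_nat n \<in> F" for n
    by (induction n) (auto intro: real_subfield_closed[OF assms])
  show ?thesis
    by (cases k rule: int_cases2) (auto intro: n real_subfield_closed(3)[OF assms])
qed

lemma real_subfield_Rats:
  assumes "real_subfield F" "x \<in> \<rat>" shows "x \<in> F"
  using assms(2) by (auto elim!: Rats_cases' intro: real_subfield_closed[OF assms(1)] real_subfield_of_int[OF assms(1)])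

lemma real_subfield_sum:
  assumes "real_subfield F" "\<And>i. i \<in> I \<Longrightarrow> f i \<in> F" shows "sum f I \<in> F"
  using assms(2) by (induction I rule: infinite_finite_induct) (auto intro: real_subfield_closed[OF assms(1)])

lemma real_subfield_prod:
  assumes "real_subfield F" "\<And>i. i \<in> I \<Longrightarrow> f i \<in> F" shows "prod f I \<in> F"
  using assms(2) by (induction I rule: infinite_finite_induct) (auto intro: real_subfield_closed[OF assms(1)])

lemma real_subfield_rat_set: "real_subfield \<rat>"
  unfolding real_subfield_def by auto

text \<open>A total function constrained only on \<open>F\<close>. Real values suffice since every
  field here is generated by square roots of nonnegative integers. \<open>\<sigma> 1 = 1\<close>
  excludes the zero map.\<close>

definition real_hom :: "real set \<Rightarrow> (real \<Rightarrow> real) \<Rightarrow> bool" where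
  "real_hom F \<sigma> \<longleftrightarrow> \<sigma> 1 = 1 \<and> (\<forall>x\<in>F. \<forall>y\<in>F. \<sigma> (x + y) = \<sigma> x + \<sigma> y \<and> \<sigma> (x * y) = \<sigma> x * \<sigma> y)"

lemma real_hom_simps:
  assumes "real_subfield F" "real_hom F \<sigma>"
  shows "\<sigma> 0 = 0" "\<sigma> 1 = 1"
    "x \<in> F \<Longrightarrow> y \<in> F \<Longrightarrow> \<sigma> (x + y) = \<sigma> x + \<sigma> y" 
    "x \<in> F \<Longrightarrow> y \<in> F \<Longrightarrow> \<sigma> (x * y) = \<sigma> x * \<sigma> y"
    "x \<in> F \<Longrightarrow> \<sigma> (- x) = - \<sigma> x"
    "x \<in> F \<Longrightarrow> y \<in> F \<Longrightarrow> \<sigma> (x - y) = \<sigma> x - \<sigma> y"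
proof -
  note c = real_subfield_closed[OF assms(1)]
  show a: "x \<in> F \<Longrightarrow> y \<in> F \<Longrightarrow> \<sigma> (x + y) = \<sigma> x + \<sigma> y" for x y
    using assms(2) unfolding real_hom_def by blast
  show "x \<in> F \<Longrightarrow> y \<in> F \<Longrightarrow> \<sigma> (x * y) = \<sigma> x * \<sigma> y" "\<sigma> 1 = 1"
    using assms(2) unfolding real_hom_def by blast+
  show z: "\<sigma> 0 = 0" using a[OF c(1) c(1)] by simp
  show m: "x \<in> F \<Longrightarrow> \<sigma> (- x) = - \<sigma> x" for x
    using a[of x "- x"] c(3)[of x] z by simp
  show "x \<in> F \<Longrightarrow> y \<in> F \<Longrightarrow> \<sigma> (x - y) = \<sigma> x - \<sigma> y"
    using a[of x "- y"] c(3)[of y] m[of y] by simp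
qed

lemma real_hom_of_int:
  assumes "real_subfield F" "real_hom F \<sigma>" shows "\<sigma> (of_int k) = of_int k"
proof -
  note s = real_hom_simps[OF assms]
  have nF: "of_nat n \<in> F" for n using real_subfield_of_int[OF assms(1), of "int n"] by simp
  have n: "\<sigma> (of_nat n) = of_nat n" for n
    by (induction n) (simp_all add: s nF real_subfield_closed[OF assms(1)])
  show ?thesis
    by (cases k rule: int_cases2) (auto simp: n s nF)
qed

lemma real_hom_sum:
  assumes "real_subfield F" "real_hom F \<sigma>" "\<And>i. i \<in> I \<Longrightarrow> f i \<in> F"
  shows "\<sigma> (sum f I) = (\<Sum>i\<in>I. \<sigma> (f i))"
  using assms(3) by (induction I rule: infinite_finite_induct)
    (auto simp: real_hom_simps[OF assms(1,2)] real_subfield_sum[OF assms(1)])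

lemma real_hom_prod:
  assumes "real_subfield F" "real_hom F \<sigma>" "\<And>i. i \<in> I \<Longrightarrow> f i \<in> F"
  shows "\<sigma> (prod f I) = (\<Prod>i\<in>I. \<sigma> (f i))"
  using assms(3) by (induction I rule: infinite_finite_induct)
    (auto simp: real_hom_simps[OF assms(1,2)] real_subfield_prod[OF assms(1)])

lemma real_hom_power:
  assumes "real_subfield F" "real_hom F \<sigma>" "x \<in> F"
  shows "\<sigma> (x ^ n) = \<sigma> x ^ n"
  using real_hom_prod[OF assms(1,2), of "{..<n}" "\<lambda>_. x"] assms(3) by simp

lemma real_subfield_power:
  assumes "real_subfield F" "x \<in> F" shows "x ^ n \<in> F"
  using real_subfield_prod[OF assms(1), of "{..<n}" "\<lambda>_. x"] assms(2) by simp

lemma real_hom_alg_int: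
  assumes "real_subfield F" "real_hom F \<sigma>" "x \<in> F" "alg_int x"
  shows "alg_int (\<sigma> x)"
proof -
  obtain p :: "int poly" where p: "lead_coeff p = 1" "poly (map_poly of_int p) x = 0"
    using assms(4) unfolding alg_int_def by blast
  have P: "poly (map_poly of_int p) y = (\<Sum>i\<le>degree p. of_int (coeff p i) * y ^ i)" for y :: real
    unfolding poly_altdef by (simp add: degree_map_poly coeff_map_poly)
  have F: "of_int (coeff p i) * x ^ i \<in> F" for i
    by (intro real_subfield_closed(6)[OF assms(1)] real_subfield_of_int real_subfield_power assms)
  have "\<sigma> (poly (map_poly of_int p) x) = poly (map_poly of_int p) (\<sigma> x)"
    unfolding P by (subst real_hom_sum[OF assms(1,2) F])
      (simp add: real_hom_simps[OF assms(1,2)] real_hom_of_int[OF assms(1,2)] real_hom_power[OF assms(1-3)]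
        real_subfield_of_int[OF assms(1)] real_subfield_power[OF assms(1,3)])
  then have "poly (map_poly of_int p) (\<sigma> x) = 0" unfolding p(2) real_hom_simps[OF assms(1,2)] by simp
  with p(1) show ?thesis unfolding alg_int_def by blast
qed

text \<open>The root may already lie in the field \<open>F\<close>, and then nothing is added; so
  lists of radicands may contain squares and repetitions.\<close>

definition adj_sqrt :: "real set \<Rightarrow> int \<Rightarrow> real set" where
  "adj_sqrt F d = {a + b * sqrt (of_int d) | a b. a \<in> F \<and> b \<in> F}"

lemma adj_sqrtI: "a \<in> F \<Longrightarrow> b \<in> F \<Longrightarrow> a + b * sqrt (of_int d) \<in> adj_sqrt F d"
  unfolding adj_sqrt_def by blast

lemma adj_sqrtE:
  assumes "x \<in> adj_sqrt F d"
  obtains a b where "a \<in> F" "b \<in> F" "x = a + b * sqrt (of_int d)"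
  using assms unfolding adj_sqrt_def by blast

lemma adj_sqrt_supset: assumes "real_subfield F" shows "F \<subseteq> adj_sqrt F d"
proof
  fix x assume "x \<in> F"
  then show "x \<in> adj_sqrt F d"
    using adj_sqrtI[of x F 0 d] real_subfield_closed(1)[OF assms] by simp
qed

lemma sqrt_in_adj_sqrt: assumes "real_subfield F" shows "sqrt (of_int d) \<in> adj_sqrt F d"
  using adj_sqrtI[of 0 F 1 d] real_subfield_closed(1,2)[OF assms] by simp

lemma adj_sqrt_subset:
  assumes "real_subfield K" "F \<subseteq> K" "sqrt (of_int d) \<in> K"
  shows "adj_sqrt F d \<subseteq> K"
  using assms(2,3) by (auto elim!: adj_sqrtE intro!: real_subfield_closed[OF assms(1)])

lemma adj_sqrt_coords_unique:
  assumes "real_subfield F" "sqrt (of_int d) \<notin> F" "a \<in> F" "b \<in> F" "a' \<in> F" "b' \<in> F"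
    and "a + b * sqrt (of_int d) = a' + b' * sqrt (of_int d)"
  shows "a = a'" "b = b'"
proof -
  note c = real_subfield_closed[OF assms(1)]
  have *: "(b - b') * sqrt (of_int d) = a' - a" using assms(7) by (simp add: algebra_simps)
  show "b = b'"
  proof (rule ccontr)
    assume "b \<noteq> b'"
    then have "sqrt (of_int d) = (a' - a) / (b - b')" using * by (simp add: field_simps)
    moreover have "(a' - a) / (b - b') \<in> F" by (intro c(7,8) assms)
    ultimately show False using assms(2) by simp
  qed
  then show "a = a'" using assms(7) by simp
qed

lemma real_subfield_adj_sqrt:
  assumes F: "real_subfield F" and d: "d \<ge> 0"
  shows "real_subfield (adj_sqrt F d)"
proof (cases "sqrt (of_int d) \<in> F")
  case True
  then have "adj_sqrt F d = F" using adj_sqrt_subset[OF F order.refl] adj_sqrt_supset[OF F] by blast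
  then show ?thesis using F by simp
next
  case False
  note c = real_subfield_closed[OF F] real_subfield_of_int[OF F]
  note s = adj_sqrt_supset[OF F]
  have sq: "sqrt (of_int d) * sqrt (of_int d) = of_int d" using d by simp
  have "- x \<in> adj_sqrt F d \<and> inverse x \<in> adj_sqrt F d" if "x \<in> adj_sqrt F d" for x
  proof -
    from that obtain a b where ab: "a \<in> F" "b \<in> F" and x: "x = a + b * sqrt (of_int d)"
      by (rule adj_sqrtE)
    have "- x = (- a) + (- b) * sqrt (of_int d)" unfolding x by simp
    then have 1: "- x \<in> adj_sqrt F d" using adj_sqrtI[of "- a" F "- b" d] c ab by simp
    \<comment> \<open>The relative norm of \<open>x\<close>. As \<open>sqrt d\<close> is not in
      \<open>F\<close>, it vanishes only for \<open>x = 0\<close>, where \<open>inverse\<close>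
      gives 0.\<close>
    define N where "N = a * a - of_int d * (b * b)"
    have NF: "N \<in> F" unfolding N_def by (intro c ab)
    have xN: "x * (a - b * sqrt (of_int d)) = N"
      unfolding x N_def using sq by (simp add: algebra_simps)
    have "inverse x \<in> adj_sqrt F d"
    proof (cases "N = 0")
      case True
      then have "x = 0 \<or> a = b * sqrt (of_int d)" using xN by auto
      moreover have "x = 0" if "a = b * sqrt (of_int d)"
        using adj_sqrt_coords_unique[OF F False ab(1) c(1) c(1) ab(2)] that x by simp
      ultimately show ?thesis using s c by auto
    next
      case False
      then have "x \<noteq> 0" using xN by auto
      then have "inverse x = a / N + (- b / N) * sqrt (of_int d)"
        using False xN by (simp add: field_simps)
      moreover have "- b / N = - (b / N)" by simp
      ultimately show ?thesis using adj_sqrtI[of "a / N" F "- b / N" d] c(3,8) ab NF by simp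
    qed
    with 1 show ?thesis by simp
  qed
  moreover have "x + y \<in> adj_sqrt F d \<and> x * y \<in> adj_sqrt F d"
    if "x \<in> adj_sqrt F d" "y \<in> adj_sqrt F d" for x y
  proof -
    from that obtain a b a' b' where ab: "a \<in> F" "b \<in> F" "a' \<in> F" "b' \<in> F"
      and x: "x = a + b * sqrt (of_int d)" "y = a' + b' * sqrt (of_int d)"
      by (elim adj_sqrtE)
    have "x + y = (a + a') + (b + b') * sqrt (of_int d)" 
      unfolding x by (simp add: algebra_simps)
    moreover have "x * y = (a * a' + of_int d * (b * b')) + (a * b' + a' * b) * sqrt (of_int d)"
      unfolding x using sq by (simp add: algebra_simps)
    ultimately show ?thesis by (auto intro!: adj_sqrtI c ab)
  qed
  ultimately show ?thesis using s c(1,2) unfolding real_subfield_def by blast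
qed

text \<open>\<open>e\<close> is a sign. Either sign respects products because only the square of
  \<open>e * sqrt d\<close>, which is \<open>d\<close>, enters them.\<close>

lemma real_hom_extend:
  assumes F: "real_subfield F" and d: "d \<ge> 0" and n: "sqrt (of_int d) \<notin> F"
    and h: "real_hom F \<sigma>" and e: "e * e = (1::real)"
  obtains \<tau> where "real_hom (adj_sqrt F d) \<tau>"
    "\<And>a b. a \<in> F \<Longrightarrow> b \<in> F \<Longrightarrow> \<tau> (a + b * sqrt (of_int d)) = \<sigma> a + \<sigma> b * (e * sqrt (of_int d))"
proof -
  note c = real_subfield_closed[OF F] real_subfield_of_int[OF F]
  note s = real_hom_simps[OF F h] real_hom_of_int[OF F h]
  have sq: "sqrt (of_int d) * sqrt (of_int d) = of_int d" using d by simp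
  \<comment> \<open>The description is well defined by uniqueness of coordinates, which rests on
    \<open>sqrt d\<close> not being in \<open>F\<close>.\<close>
  define \<tau> where "\<tau> = (\<lambda>x. THE y. \<exists>a\<in>F. \<exists>b\<in>F. x = a + b * sqrt (of_int d) \<and>
     y = \<sigma> a + \<sigma> b * (e * sqrt (of_int d)))"
  have t: "\<tau> (a + b * sqrt (of_int d)) = \<sigma> a + \<sigma> b * (e * sqrt (of_int d))"
    if ab: "a \<in> F" "b \<in> F" for a b
    unfolding \<tau>_def
  proof (rule the_equality)
    fix y assume "\<exists>a'\<in>F. \<exists>b'\<in>F. a + b * sqrt (of_int d) = a' + b' * sqrt (of_int d) \<and>
     y = \<sigma> a' + \<sigma> b' * (e * sqrt (of_int d))"
    then show "y = \<sigma> a + \<sigma> b * (e * sqrt (of_int d))"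
      using adj_sqrt_coords_unique[OF F n ab] by metis
  qed (use ab in blast)
  have "\<tau> 1 = 1" using t[OF c(2,1)] s by simp
  moreover have "\<tau> (x + y) = \<tau> x + \<tau> y \<and> \<tau> (x * y) = \<tau> x * \<tau> y"
    if "x \<in> adj_sqrt F d" "y \<in> adj_sqrt F d" for x y
  proof -
    from that obtain a b a' b' where ab: "a \<in> F" "b \<in> F" "a' \<in> F" "b' \<in> F"
      and x: "x = a + b * sqrt (of_int d)" "y = a' + b' * sqrt (of_int d)"
      by (elim adj_sqrtE)
    have p: "x + y = (a + a') + (b + b') * sqrt (of_int d)" 
      unfolding x by (simp add: algebra_simps)
    have m: "x * y = (a * a' + of_int d * (b * b')) + (a * b' + a' * b) * sqrt (of_int d)"
      unfolding x using sq by (simp add: algebra_simps)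
    have "\<tau> (x + y) = \<sigma> (a + a') + \<sigma> (b + b') * (e * sqrt (of_int d))"
      unfolding p by (intro t c ab)
    then have 1: "\<tau> (x + y) = \<tau> x + \<tau> y"
      unfolding x t[OF ab(1,2)] t[OF ab(3,4)] using ab s by (simp add: algebra_simps)
    have "\<tau> (x * y) = \<sigma> (a * a' + of_int d * (b * b')) + \<sigma> (a * b' + a' * b) * (e * sqrt (of_int d))"
      unfolding m by (intro t c ab)
    also have "\<dots> = \<sigma> a * \<sigma> a' + of_int d * (\<sigma> b * \<sigma> b') + (\<sigma> a * \<sigma> b' + \<sigma> a' * \<sigma> b) * (e * sqrt (of_int d))"
      using ab s c by simp
    also have "\<dots> = \<sigma> a * \<sigma> a' + (\<sigma> b * \<sigma> b') * (e * e) * (sqrt (of_int d) * sqrt (of_int d))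
         + (\<sigma> a * \<sigma> b' + \<sigma> a' * \<sigma> b) * (e * sqrt (of_int d))"
      unfolding e sq by simp
    also have "\<dots> = \<tau> x * \<tau> y"
      unfolding x t[OF ab(1,2)] t[OF ab(3,4)] by (simp only: algebra_simps)
    finally show ?thesis using 1 by simp
  qed
  ultimately have "real_hom (adj_sqrt F d) \<tau>" unfolding real_hom_def by blast
  then show ?thesis using t by (rule that)
qed

text \<open>Substitute for the product of all conjugates: the relative norm to the next lower field of the tower
  preserves integrality and smallness of all conjugates, down to the rationals.\<close>

definition norm_separated :: "real set \<Rightarrow> bool" where
  "norm_separated F \<longleftrightarrow> (\<forall>y\<in>F. alg_int y \<longrightarrow> (\<forall>\<sigma>. real_hom F \<sigma> \<longrightarrow> \<bar>\<sigma> y\<bar> < 1) \<longrightarrow> y = 0)"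

lemma norm_separated_Rats: "norm_separated \<rat>"
  unfolding norm_separated_def
proof (intro ballI impI)
  fix y :: real assume y: "y \<in> \<rat>" "alg_int y" "\<forall>\<sigma>. real_hom \<rat> \<sigma> \<longrightarrow> \<bar>\<sigma> y\<bar> < 1"
  have "real_hom \<rat> (\<lambda>x. x)" unfolding real_hom_def by simp
  then have "\<bar>y\<bar> < 1" using y(3) by blast
  moreover have "y \<in> \<int>" using y by (intro alg_int_rat_imp_int)
  ultimately show "y = 0" using Ints_nonzero_abs_less1 by blast
qed

text \<open>A homomorphism of \<open>F\<close> has the two extensions \<open>\<tau>1\<close> and
  \<open>\<tau>2\<close>, and its value at the relative norm \<open>z\<close> is the product of
  their values at \<open>y\<close>, both below 1 in size. Once \<open>z = 0\<close>, uniqueness of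
  coordinates gives \<open>y = 0\<close>.\<close>

lemma norm_separated_adj_sqrt:
  assumes F: "real_subfield F" and d: "d \<ge> 0" and N: "norm_separated F"
  shows "norm_separated (adj_sqrt F d)"
proof (cases "sqrt (of_int d) \<in> F")
  case True
  then have "adj_sqrt F d = F" using adj_sqrt_subset[OF F order.refl] adj_sqrt_supset[OF F] by blast
  then show ?thesis using N by simp
next
  case False
  note c = real_subfield_closed[OF F] real_subfield_of_int[OF F]
  have sq: "sqrt (of_int d) * sqrt (of_int d) = of_int d" using d by simp
  show ?thesis unfolding norm_separated_def
  proof (intro ballI impI)
    fix y assume y: "y \<in> adj_sqrt F d" "alg_int y" and b: "\<forall>\<sigma>. real_hom (adj_sqrt F d) \<sigma> \<longrightarrow> \<bar>\<sigma> y\<bar> < 1"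
    obtain a b where ab: "a \<in> F" "b \<in> F" and yab: "y = a + b * sqrt (of_int d)"
      using adj_sqrtE[OF y(1)] .
    define z where "z = a * a - of_int d * (b * b)"
    have zF: "z \<in> F" unfolding z_def by (intro c ab)
    have "real_hom F (\<lambda>x. x)" unfolding real_hom_def by simp
    then obtain \<tau> where \<tau>: "real_hom (adj_sqrt F d) \<tau>" "\<tau> y = a + b * ((-1) * sqrt (of_int d))"
      using real_hom_extend[OF F d False, of "\<lambda>x. x" "-1"] ab yab by (metis mult_minus1 minus_minus)
    have "z = y * (a + b * ((-1) * sqrt (of_int d)))" unfolding yab z_def using sq by (simp add: algebra_simps)
    then have zy: "z = y * \<tau> y" unfolding \<tau>(2) .
    have "alg_int z" unfolding zy
      by (intro alg_int_mult y real_hom_alg_int[OF real_subfield_adj_sqrt[OF F d] \<tau>(1)])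
    moreover have "\<bar>\<sigma> z\<bar> < 1" if \<sigma>: "real_hom F \<sigma>" for \<sigma>
    proof -
      obtain \<tau>1 where \<tau>1: "real_hom (adj_sqrt F d) \<tau>1" "\<tau>1 y = \<sigma> a + \<sigma> b * (1 * sqrt (of_int d))"
        using real_hom_extend[OF F d False \<sigma>, of 1] ab yab by (metis mult_1)
      obtain \<tau>2 where \<tau>2: "real_hom (adj_sqrt F d) \<tau>2" "\<tau>2 y = \<sigma> a + \<sigma> b * ((-1) * sqrt (of_int d))"
        using real_hom_extend[OF F d False \<sigma>, of "-1"] ab yab by (metis mult_minus1 minus_minus)
      have "\<sigma> z = \<sigma> a * \<sigma> a - of_int d * (\<sigma> b * \<sigma> b)"
        unfolding z_def using ab c by (simp add: real_hom_simps[OF F \<sigma>] real_hom_of_int[OF F \<sigma>])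
      also have "\<dots> = \<tau>1 y * \<tau>2 y" unfolding \<tau>1 \<tau>2 using sq by (simp add: algebra_simps)
      finally have "\<bar>\<sigma> z\<bar> = \<bar>\<tau>1 y\<bar> * \<bar>\<tau>2 y\<bar>" by (simp add: abs_mult)
      also have "\<dots> < 1 * 1" using b \<tau>1(1) \<tau>2(1) by (intro mult_strict_mono') auto
      finally show ?thesis by simp
    qed
    ultimately have "z = 0" using N zF unfolding norm_separated_def by blast
    then have "y = 0 \<or> a + 0 * sqrt (of_int d) = 0 + b * sqrt (of_int d)" unfolding zy \<tau>(2) by auto
    then show "y = 0"
      using adj_sqrt_coords_unique[OF F False ab(1) c(1) c(1) ab(2)] yab by auto
  qed
qed

text \<open>The last radicand of the list is adjoined first. Hence \<open>ds @ [5, 3, 2]\<close>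
  begins with the roots of 2, 3 and 5, where signs can be prescribed before the rest is
  added.\<close>

definition sqrt_tower :: "int list \<Rightarrow> real set" where
  "sqrt_tower ds = foldr (\<lambda>d F. adj_sqrt F d) ds \<rat>"

lemma sqrt_tower_Nil [simp]: "sqrt_tower [] = \<rat>"
  and sqrt_tower_Cons [simp]: "sqrt_tower (d # ds) = adj_sqrt (sqrt_tower ds) d"
  unfolding sqrt_tower_def by simp_all

lemma real_subfield_sqrt_tower: "\<forall>d\<in>set ds. d \<ge> 0 \<Longrightarrow> real_subfield (sqrt_tower ds)"
  by (induction ds) (auto intro: real_subfield_rat_set real_subfield_adj_sqrt)

lemma norm_separated_sqrt_tower: "\<forall>d\<in>set ds. d \<ge> 0 \<Longrightarrow> norm_separated (sqrt_tower ds)"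
  by (induction ds) (auto intro: norm_separated_Rats norm_separated_adj_sqrt real_subfield_sqrt_tower)

lemma sqrt_in_sqrt_tower: "\<forall>d\<in>set ds. d \<ge> 0 \<Longrightarrow> d \<in> set ds \<Longrightarrow> sqrt (of_int d) \<in> sqrt_tower ds"
proof (induction ds)
  case (Cons e ds)
  then have F: "real_subfield (sqrt_tower ds)" by (intro real_subfield_sqrt_tower) auto
  then show ?case using Cons sqrt_in_adj_sqrt[OF F] adj_sqrt_supset[OF F] by auto
qed simp

lemma sqrt_tower_mono:
  assumes "\<forall>d\<in>set es. d \<ge> 0" "set ds \<subseteq> set es"
  shows "sqrt_tower ds \<subseteq> sqrt_tower es"
  using assms(2)
proof (induction ds)
  case Nil
  then show ?case using real_subfield_Rats[OF real_subfield_sqrt_tower[OF assms(1)]] by auto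
next
  case (Cons d ds)
  then show ?case
    using adj_sqrt_subset[OF real_subfield_sqrt_tower[OF assms(1)]] sqrt_in_sqrt_tower[OF assms(1)] by auto
qed

text \<open>Each new root is kept fixed (\<open>e = 1\<close> in \<open>real_hom_extend\<close>); a
  root already present requires no extension.\<close>

lemma real_hom_extend_tower:
  assumes "\<forall>d\<in>set (es @ ds). d \<ge> 0" "real_hom (sqrt_tower ds) \<sigma>"
  shows "\<exists>\<tau>. real_hom (sqrt_tower (es @ ds)) \<tau> \<and> (\<forall>x\<in>sqrt_tower ds. \<tau> x = \<sigma> x)"
  using assms(1)
proof (induction es)
  case (Cons e es)
  then obtain \<tau> where \<tau>: "real_hom (sqrt_tower (es @ ds)) \<tau>" "\<forall>x\<in>sqrt_tower ds. \<tau> x = \<sigma> x" by auto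
  have F: "real_subfield (sqrt_tower (es @ ds))" using Cons.prems by (intro real_subfield_sqrt_tower) auto
  note c = real_subfield_closed[OF F]
  show ?case
  proof (cases "sqrt (of_int e) \<in> sqrt_tower (es @ ds)")
    case True
    then have "sqrt_tower ((e # es) @ ds) = sqrt_tower (es @ ds)" 
      using adj_sqrt_subset[OF F order.refl True] adj_sqrt_supset[OF F] by auto
    then show ?thesis using \<tau> by auto
  next
    case False
    obtain \<rho> where \<rho>: "real_hom (adj_sqrt (sqrt_tower (es @ ds)) e) \<rho>"
      "\<And>a b. a \<in> sqrt_tower (es @ ds) \<Longrightarrow> b \<in> sqrt_tower (es @ ds) \<Longrightarrow>
         \<rho> (a + b * sqrt (of_int e)) = \<tau> a + \<tau> b * (1 * sqrt (of_int e))"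
      using real_hom_extend[OF F _ False \<tau>(1), of 1] Cons.prems by auto
    have "\<rho> x = \<sigma> x" if x: "x \<in> sqrt_tower ds" for x
    proof -
      have "x \<in> sqrt_tower (es @ ds)" using sqrt_tower_mono[of "es @ ds" ds] Cons.prems x by auto
      then show ?thesis using \<rho>(2)[of x 0] c(1) real_hom_simps(1)[OF F \<tau>(1)] \<tau>(2) x by simp
    qed
    then show ?thesis using \<rho>(1) by auto
  qed
qed (use assms(2) in auto)

lemma quad_compositum_in_sqrt_tower:
  assumes "x \<in> quad_compositum"
  shows "\<exists>ds. (\<forall>d\<in>set ds. d \<ge> 0) \<and> x \<in> sqrt_tower ds"
  using assms
proof (induction rule: quad_compositum.induct)
  case (gen d x)
  then have "x \<in> sqrt_tower [d]"
    unfolding quad_int_ring_def quad_field_def by (auto intro!: adj_sqrtI)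
  then show ?case using gen by (intro exI[of _ "[d]"]) auto
next
  case one
  then show ?case by (intro exI[of _ "[]"]) auto
next
  case (neg x)
  then show ?case using real_subfield_closed(3)[OF real_subfield_sqrt_tower] by blast
next
  case (add x y)
  then obtain ds es where d: "\<forall>d\<in>set (ds @ es). d \<ge> 0" and x: "x \<in> sqrt_tower ds" "y \<in> sqrt_tower es" by auto
  have "x \<in> sqrt_tower (ds @ es)" "y \<in> sqrt_tower (ds @ es)"
    using sqrt_tower_mono[OF d] x by auto
  then show ?case using real_subfield_closed(5)[OF real_subfield_sqrt_tower[OF d]] d by blast
next
  case (mult x y)
  then obtain ds es where d: "\<forall>d\<in>set (ds @ es). d \<ge> 0" and x: "x \<in> sqrt_tower ds" "y \<in> sqrt_tower es" by auto
  have "x \<in> sqrt_tower (ds @ es)" "y \<in> sqrt_tower (ds @ es)"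
    using sqrt_tower_mono[OF d] x by auto
  then show ?case using real_subfield_closed(6)[OF real_subfield_sqrt_tower[OF d]] d by blast
qed

lemma finite_quad_compositum_in_sqrt_tower:
  assumes "finite X" "X \<subseteq> quad_compositum"
  shows "\<exists>ds. (\<forall>d\<in>set ds. d \<ge> 0) \<and> X \<subseteq> sqrt_tower ds"
  using assms
proof (induction X rule: finite_induct)
  case (insert x X)
  obtain ds where ds: "\<forall>d\<in>set ds. d \<ge> 0" "x \<in> sqrt_tower ds"
    using quad_compositum_in_sqrt_tower[of x] insert.prems by auto
  obtain es where es: "\<forall>d\<in>set es. d \<ge> 0" "X \<subseteq> sqrt_tower es" using insert by auto
  have d: "\<forall>d\<in>set (ds @ es). d \<ge> 0" using ds es by auto
  have "sqrt_tower ds \<subseteq> sqrt_tower (ds @ es)" "sqrt_tower es \<subseteq> sqrt_tower (ds @ es)"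
    by (intro sqrt_tower_mono[OF d]; simp)+
  then show ?case using ds es d by blast
qed (auto intro: exI[of _ "[]"])

text \<open>Squaring \<open>sqrt q = a + b * sqrt p\<close> and comparing coordinates gives
  \<open>a * b = 0\<close>. Then \<open>b = 0\<close> puts \<open>sqrt q\<close> into
  \<open>F\<close>, and \<open>a = 0\<close> puts \<open>sqrt (p * q)\<close> there.\<close>

lemma sqrt_notin_adj_sqrt:
  assumes F: "real_subfield F" and "p \<ge> 0" "q \<ge> 0" "sqrt (of_int q) \<notin> F" "sqrt (of_int (p * q)) \<notin> F"
  shows "sqrt (of_int q) \<notin> adj_sqrt F p"
proof
  note c = real_subfield_closed[OF F] real_subfield_of_int[OF F]
  assume q: "sqrt (of_int q) \<in> adj_sqrt F p"
  show False
  proof (cases "sqrt (of_int p) \<in> F")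
    case True
    then show False using q assms(4) adj_sqrt_subset[OF F order.refl True] by blast
  next
    case False
    obtain a b where ab: "a \<in> F" "b \<in> F" "sqrt (of_int q) = a + b * sqrt (of_int p)"
      using adj_sqrtE[OF q] .
    have "of_int q = (a + b * sqrt (of_int p)) * (a + b * sqrt (of_int p))"
      unfolding ab(3)[symmetric] using assms(3) by simp
    also have "\<dots> = (a * a + of_int p * (b * b)) + (2 * (a * b)) * sqrt (of_int p)"
      using assms(2) by (simp add: algebra_simps)
    finally have *: "of_int q + 0 * sqrt (of_int p) = \<dots>" by simp
    have 2: "2 \<in> F" using c(9)[of 2] by simp
    have "0 = 2 * (a * b)"
      by (rule adj_sqrt_coords_unique(2)[OF F False _ _ _ _ *]) (intro c ab 2)+
    then consider "a = 0" | "b = 0" by auto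
    then show False
    proof cases
      case 1
      then have "sqrt (of_int (p * q)) = b * of_int p" using ab(3) assms(2) by (simp add: real_sqrt_mult)
      then show False using assms(5) c ab by simp
    next
      case 2
      then show False using assms(4) ab by simp
    qed
  qed
qed

lemma sqrt_int_rational_imp_square:
  assumes "sqrt (of_int n) \<in> \<rat>" "n \<ge> 0" obtains m where "n = m * m"
proof -
  have "algebraic_int (sqrt (of_int n))" by (intro algebraic_int_sqrt int_imp_algebraic_int) simp
  then have "sqrt (of_int n) \<in> \<int>" using assms by (intro rational_algebraic_int_is_int)
  then obtain m where m: "sqrt (of_int n) = of_int m" by (elim Ints_cases)
  have "real_of_int n = of_int (m * m)" using assms(2) m by (metis of_int_0_le_iff of_int_mult real_sqrt_mult_self abs_of_nonneg)
  then show ?thesis using that of_int_eq_iff by blast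
qed

lemma sqrt_int_irrational:
  assumes "k * k < n" "n < (k + 1) * (k + 1)" "k \<ge> 0" shows "sqrt (of_int n) \<notin> \<rat>"
proof
  assume "sqrt (of_int n) \<in> \<rat>"
  moreover have "n \<ge> 0" using assms(1) zero_le_square[of k] by linarith
  ultimately obtain m where m: "n = m * m" by (rule sqrt_int_rational_imp_square)
  have "\<bar>k\<bar> < \<bar>m\<bar>" "\<bar>m\<bar> < \<bar>k + 1\<bar>" using assms(1,2) m
    by (metis abs_mult_less abs_mult_self_eq linorder_not_le abs_le_square_iff power2_eq_square)+
  then show False using assms(3) by linarith
qed

text \<open>Entries of different types must be conjugated independently. The signs are therefore
  chosen at the bottom of the tower, where the three roots are independent, and extended through
  \<open>ds\<close>, whose radicands may be related to 2, 3 and 5.\<close>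

lemma real_hom_signs:
  assumes "e2 * e2 = (1::real)" "e3 * e3 = (1::real)" "e5 * e5 = (1::real)" "\<forall>d\<in>set ds. d \<ge> 0"
  obtains \<sigma> where "real_hom (sqrt_tower (ds @ [5, 3, 2])) \<sigma>" 
    "\<sigma> (sqrt 2) = e2 * sqrt 2" "\<sigma> (sqrt 3) = e3 * sqrt 3" "\<sigma> (sqrt 5) = e5 * sqrt 5"
proof -
  \<comment> \<open>The radicands are the products of all nonempty subsets of {2, 3, 5}; each use of
    \<open>sqrt_notin_adj_sqrt\<close> consumes the conditions for \<open>q\<close> and
    \<open>p * q\<close>.\<close>
  have irr: "sqrt (of_int 2) \<notin> \<rat>" "sqrt (of_int 3) \<notin> \<rat>" "sqrt (of_int 5) \<notin> \<rat>" "sqrt (of_int 6) \<notin> \<rat>"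
    "sqrt (of_int 10) \<notin> \<rat>" "sqrt (of_int 15) \<notin> \<rat>" "sqrt (of_int 30) \<notin> \<rat>"
    by (rule sqrt_int_irrational[of 1] sqrt_int_irrational[of 2] sqrt_int_irrational[of 3] sqrt_int_irrational[of 5]; simp)+
  have F: "real_subfield (sqrt_tower [])" "real_subfield (sqrt_tower [2])" "real_subfield (sqrt_tower [3, 2])"
    by (intro real_subfield_sqrt_tower; simp)+
  have n2: "sqrt (of_int 2) \<notin> sqrt_tower []" using irr by simp
  have n: "sqrt (of_int 3) \<notin> sqrt_tower [2]" "sqrt (of_int 5) \<notin> sqrt_tower [2]" "sqrt (of_int 15) \<notin> sqrt_tower [2]"
    unfolding sqrt_tower_Cons by (rule sqrt_notin_adj_sqrt; use irr F in simp)+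
  have n5: "sqrt (of_int 5) \<notin> sqrt_tower [3, 2]"
    unfolding sqrt_tower_Cons[of 3] by (rule sqrt_notin_adj_sqrt; use n F in simp)
  have "real_hom (sqrt_tower []) (\<lambda>x. x)" unfolding real_hom_def by simp
  then obtain s2 where s2: "real_hom (sqrt_tower [2]) s2"
    "\<And>a b. a \<in> sqrt_tower [] \<Longrightarrow> b \<in> sqrt_tower [] \<Longrightarrow> s2 (a + b * sqrt (of_int 2)) = a + b * (e2 * sqrt (of_int 2))"
    using real_hom_extend[OF F(1) _ n2 _ assms(1)] by (metis sqrt_tower_Cons zero_le_numeral)
  obtain s3 where s3: "real_hom (sqrt_tower [3, 2]) s3"
    "\<And>a b. a \<in> sqrt_tower [2] \<Longrightarrow> b \<in> sqrt_tower [2] \<Longrightarrow> s3 (a + b * sqrt (of_int 3)) = s2 a + s2 b * (e3 * sqrt (of_int 3))"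
    using real_hom_extend[OF F(2) _ n(1) s2(1) assms(2)] by (metis sqrt_tower_Cons zero_le_numeral)
  obtain s5 where s5: "real_hom (sqrt_tower [5, 3, 2]) s5"
    "\<And>a b. a \<in> sqrt_tower [3, 2] \<Longrightarrow> b \<in> sqrt_tower [3, 2] \<Longrightarrow> s5 (a + b * sqrt (of_int 5)) = s3 a + s3 b * (e5 * sqrt (of_int 5))"
    using real_hom_extend[OF F(3) _ n5 s3(1) assms(3)] by (metis sqrt_tower_Cons zero_le_numeral)
  have z: "s2 0 = 0" "s2 1 = 1" "s3 0 = 0" "s3 1 = 1" 
    using real_hom_simps(1,2)[OF F(2) s2(1)] real_hom_simps(1,2)[OF F(3) s3(1)] by auto
  have m2: "sqrt (of_int 2) \<in> sqrt_tower [2]" and m3: "sqrt (of_int 3) \<in> sqrt_tower [3, 2]"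
     and m2': "sqrt (of_int 2) \<in> sqrt_tower [3, 2]"
    by (intro sqrt_in_sqrt_tower; simp)+
  have v2: "s2 (sqrt 2) = e2 * sqrt 2" using s2(2)[of 0 1] by simp
  have v3: "s3 (sqrt 3) = e3 * sqrt 3" "s3 (sqrt 2) = e2 * sqrt 2"
    using s3(2)[of 0 1] s3(2)[of "sqrt 2" 0] m2 z v2 real_subfield_closed(1,2)[OF F(2)] by simp_all
  have v5: "s5 (sqrt 5) = e5 * sqrt 5" "s5 (sqrt 3) = e3 * sqrt 3" "s5 (sqrt 2) = e2 * sqrt 2"
    using s5(2)[of 0 1] s5(2)[of "sqrt 3" 0] s5(2)[of "sqrt 2" 0] m3 m2' z v3 real_subfield_closed(1,2)[OF F(3)]
    by simp_all
  obtain \<tau> where "real_hom (sqrt_tower (ds @ [5, 3, 2])) \<tau>" "\<forall>x\<in>sqrt_tower [5, 3, 2]. \<tau> x = s5 x"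
    using real_hom_extend_tower[of ds "[5, 3, 2]" s5] assms(4) s5(1) by auto
  moreover have "sqrt (of_int k) \<in> sqrt_tower [5, 3, 2]" if "k \<in> set [5, 3, 2]" for k
    by (intro sqrt_in_sqrt_tower that) simp
  from this[of 2] this[of 3] this[of 5] have "sqrt 2 \<in> sqrt_tower [5, 3, 2]" "sqrt 3 \<in> sqrt_tower [5, 3, 2]" "sqrt 5 \<in> sqrt_tower [5, 3, 2]"
    by (simp_all del: sqrt_tower_Cons)
  ultimately show ?thesis using that[of \<tau>] v5 by (metis (no_types))
qed

section \<open>Classification of the entries\<close>

lemma quad_compositum_closed:
  "0 \<in> quad_compositum"
  "x \<in> quad_compositum \<Longrightarrow> y \<in> quad_compositum \<Longrightarrow> x - y \<in> quad_compositum"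
  using quad_compositum.add[OF quad_compositum.one quad_compositum.neg[OF quad_compositum.one]]
    quad_compositum.add[of x "- y"] quad_compositum.neg[of y] by auto

lemma quad_compositum_of_int: "of_int k \<in> quad_compositum"
proof -
  have n: "of_nat n \<in> quad_compositum" for n
    by (induction n) (auto intro: quad_compositum.intros quad_compositum_closed)
  show ?thesis
    by (cases k rule: int_cases2) (auto intro: n quad_compositum.neg)
qed

lemma quad_compositum_power: "x \<in> quad_compositum \<Longrightarrow> x ^ n \<in> quad_compositum"
  by (induction n) (auto intro: quad_compositum.intros)

text \<open>Congruences are taken in the compositum of the rings of integers, not in the larger ring of integers
  of the compositum: \<open>x ^ 8 \<equiv> x ^ 2\<close> mod 2 fails there for \<open>x = (sqrt 2 + sqrt 6) / 2\<close>.\<close>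

definition qc_cong :: "int \<Rightarrow> real \<Rightarrow> real \<Rightarrow> bool" where
  "qc_cong m x y \<longleftrightarrow> (\<exists>z\<in>quad_compositum. x = y + of_int m * z)"

lemma qc_congI: "z \<in> quad_compositum \<Longrightarrow> x = y + of_int m * z \<Longrightarrow> qc_cong m x y"
  unfolding qc_cong_def by blast

lemma qc_cong_refl: "qc_cong m x x"
  by (rule qc_congI[OF quad_compositum_closed(1)]) simp

lemma qc_cong_sym: "qc_cong m x y \<Longrightarrow> qc_cong m y x"
  unfolding qc_cong_def using quad_compositum.neg by force

lemma qc_cong_trans [trans]: "qc_cong m x y \<Longrightarrow> qc_cong m y z \<Longrightarrow> qc_cong m x z"
  unfolding qc_cong_def using quad_compositum.add by (force simp: algebra_simps)

lemma qc_cong_add: "qc_cong m x y \<Longrightarrow> qc_cong m x' y' \<Longrightarrow> qc_cong m (x + x') (y + y')"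
  unfolding qc_cong_def
proof (elim bexE)
  fix z z' assume "z \<in> quad_compositum" "z' \<in> quad_compositum" "x = y + of_int m * z" "x' = y' + of_int m * z'"
  then show "\<exists>z\<in>quad_compositum. x + x' = y + y' + real_of_int m * z"
    by (intro bexI[of _ "z + z'"]) (auto intro: quad_compositum.add simp: algebra_simps)
qed

lemma qc_cong_mult:
  assumes "qc_cong m x y" "qc_cong m x' y'" "y \<in> quad_compositum" "y' \<in> quad_compositum"
  shows "qc_cong m (x * x') (y * y')"
proof -
  obtain z z' where z: "z \<in> quad_compositum" "z' \<in> quad_compositum" "x = y + of_int m * z" "x' = y' + of_int m * z'"
    using assms(1,2) unfolding qc_cong_def by blast
  show ?thesis
    by (rule qc_congI[of "y * z' + z * y' + of_int m * (z * z')"])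
      (auto intro!: quad_compositum.add quad_compositum.mult quad_compositum_of_int z assms simp: z(3,4) algebra_simps)
qed

lemma qc_cong_power:
  assumes "qc_cong m x y" "y \<in> quad_compositum"
  shows "qc_cong m (x ^ n) (y ^ n)"
  by (induction n) (auto intro: qc_cong_refl qc_cong_mult assms quad_compositum_power)

lemma qc_cong_of_int: "m dvd k - l \<Longrightarrow> qc_cong m (of_int k) (of_int l)"
proof -
  assume "m dvd k - l"
  then obtain c where "k = l + m * c" unfolding dvd_def by (metis add.commute diff_add_cancel)
  then show ?thesis by (intro qc_congI[OF quad_compositum_of_int[of c]]) simp
qed

section \<open>Frobenius congruences modulo 2 and 3\<close>

lemma qc_cong_frobenius_2:
  assumes "x \<in> quad_compositum" "y \<in> quad_compositum"
  shows "qc_cong 2 ((x + y) ^ 2) (x ^ 2 + y ^ 2)"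
  by (rule qc_congI[of "x * y"]) (auto intro: quad_compositum.mult assms simp: power2_eq_square algebra_simps)

lemma qc_cong_frobenius_3:
  assumes "x \<in> quad_compositum" "y \<in> quad_compositum"
  shows "qc_cong 3 ((x + y) ^ 3) (x ^ 3 + y ^ 3)"
  by (rule qc_congI[of "x * x * y + x * y * y"])
    (auto intro!: quad_compositum.mult quad_compositum.add assms simp: power3_eq_cube algebra_simps)

lemma qc_cong_frobenius_8:
  assumes "x \<in> quad_compositum" "y \<in> quad_compositum"
  shows "qc_cong 2 ((x + y) ^ 8) (x ^ 8 + y ^ 8)"
proof -
  note R = quad_compositum.add quad_compositum_power assms
  have "qc_cong 2 (((x + y) ^ 2) ^ 4) ((x ^ 2 + y ^ 2) ^ 4)"
    by (intro qc_cong_power qc_cong_frobenius_2 R)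
  also have "(x ^ 2 + y ^ 2) ^ 4 = ((x ^ 2 + y ^ 2) ^ 2) ^ 2" by simp
  also have "qc_cong 2 (((x ^ 2 + y ^ 2) ^ 2) ^ 2) (((x ^ 2) ^ 2 + (y ^ 2) ^ 2) ^ 2)"
    by (intro qc_cong_power qc_cong_frobenius_2 R)
  also have "qc_cong 2 (((x ^ 2) ^ 2 + (y ^ 2) ^ 2) ^ 2) (((x ^ 2) ^ 2) ^ 2 + ((y ^ 2) ^ 2) ^ 2)"
    by (intro qc_cong_frobenius_2 R)
  finally show ?thesis by simp
qed

lemma qc_cong_frobenius_27:
  assumes "x \<in> quad_compositum" "y \<in> quad_compositum"
  shows "qc_cong 3 ((x + y) ^ 27) (x ^ 27 + y ^ 27)"
proof -
  note R = quad_compositum.add quad_compositum_power assms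
  have "qc_cong 3 (((x + y) ^ 3) ^ 9) ((x ^ 3 + y ^ 3) ^ 9)"
    by (intro qc_cong_power qc_cong_frobenius_3 R)
  also have "(x ^ 3 + y ^ 3) ^ 9 = ((x ^ 3 + y ^ 3) ^ 3) ^ 3" by simp
  also have "qc_cong 3 (((x ^ 3 + y ^ 3) ^ 3) ^ 3) (((x ^ 3) ^ 3 + (y ^ 3) ^ 3) ^ 3)"
    by (intro qc_cong_power qc_cong_frobenius_3 R)
  also have "qc_cong 3 (((x ^ 3) ^ 3 + (y ^ 3) ^ 3) ^ 3) (((x ^ 3) ^ 3) ^ 3 + ((y ^ 3) ^ 3) ^ 3)"
    by (intro qc_cong_frobenius_3 R)
  finally show ?thesis by simp
qed

text \<open>\<open>u\<close> is the trace and \<open>- v\<close> the norm of \<open>x\<close>; both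
  are rational algebraic integers. If \<open>sqrt d\<close> is rational, then \<open>x\<close>
  itself is an integer and \<open>u = x\<close>, \<open>v = 0\<close> work.\<close>

lemma quad_int_ring_quadratic:
  assumes "x \<in> quad_int_ring d" "d > 1"
  obtains u v :: int where "x ^ 2 = of_int u * x + of_int v"
proof -
  have x: "alg_int x" using assms unfolding quad_int_ring_def by blast
  obtain a b where ab: "a \<in> \<rat>" "b \<in> \<rat>" "x = a + b * sqrt (of_int d)"
    using assms(1) unfolding quad_int_ring_def quad_field_def by (blast intro: Rats_of_rat)
  show ?thesis
  proof (cases "sqrt (of_int d) \<in> \<rat>")
    case True
    then have "x \<in> \<int>" using ab x by (intro alg_int_rat_imp_int) auto
    then obtain k where "x = of_int k" by (elim Ints_cases)
    then show ?thesis using that[of k 0] by (simp add: power2_eq_square)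
  next
    case False
    have d: "d \<ge> 0" and sq: "sqrt (of_int d) * sqrt (of_int d) = of_int d" using assms(2) by simp_all
    have "real_hom \<rat> (\<lambda>x. x)" unfolding real_hom_def by simp
    then obtain \<tau> where \<tau>: "real_hom (adj_sqrt \<rat> d) \<tau>" "\<tau> x = a + b * ((-1) * sqrt (of_int d))"
      using real_hom_extend[OF real_subfield_rat_set d False, of "\<lambda>x. x" "-1"] ab
      by (metis mult_minus1 minus_minus)
    have y: "alg_int (\<tau> x)"
      using real_hom_alg_int[OF real_subfield_adj_sqrt[OF real_subfield_rat_set d] \<tau>(1) _ x] ab adj_sqrtI by blast
    have "x + \<tau> x = 2 * a" unfolding \<tau>(2) using ab by simp
    then have "x + \<tau> x \<in> \<rat>" using ab(1) by (metis Rats_mult Rats_number_of)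
    then have "x + \<tau> x \<in> \<int>" by (intro alg_int_rat_imp_int alg_int_add x y)
    then obtain u where u: "x + \<tau> x = of_int u" by (elim Ints_cases)
    have "x * (a + b * ((-1) * sqrt (of_int d))) = a * a - b * b * of_int d"
      unfolding ab(3) using sq by (simp add: algebra_simps)
    then have "x * \<tau> x = a * a - b * b * of_int d" unfolding \<tau>(2) .
    moreover have "a * a - b * b * of_int d \<in> \<rat>" using ab by simp
    ultimately have "x * \<tau> x \<in> \<rat>" by metis
    then have "x * \<tau> x \<in> \<int>" by (intro alg_int_rat_imp_int alg_int_mult x y)
    then obtain v where v: "x * \<tau> x = of_int v" by (elim Ints_cases)
    have "x ^ 2 = (x + \<tau> x) * x - x * \<tau> x" by (simp add: power2_eq_square algebra_simps)
    then show ?thesis using that[of u "- v"] u v by simp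
  qed
qed

text \<open>Modulo 2 both powers are additive and multiplicative, so generators decide. For odd
  \<open>u\<close> even x ^ 4 \<equiv> x holds; for even \<open>u\<close> one only has x ^ 2
  \<equiv> v, an integer. One further squaring gives exponents that serve both cases.\<close>

lemma quad_compositum_cong_2:
  assumes "x \<in> quad_compositum" shows "qc_cong 2 (x ^ 8) (x ^ 2)"
  using assms
proof (induction rule: quad_compositum.induct)
  case (gen d x)
  then have x: "x \<in> quad_compositum" by (intro quad_compositum.gen)
  note R = quad_compositum.add quad_compositum_power quad_compositum.mult quad_compositum_of_int x
  obtain u v where uv: "x ^ 2 = of_int u * x + of_int v" using quad_int_ring_quadratic gen by metis
  have v: "qc_cong 2 ((of_int v) ^ n) (of_int v)" if "n > 0" for n
    using qc_cong_of_int[of 2 "v ^ n" v] that by simp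
  show ?case
  proof (cases "even u")
    case True
    then obtain w where w: "u = 2 * w" by (elim evenE)
    have 1: "qc_cong 2 (x ^ 2) (of_int v)"
      by (rule qc_congI[of "of_int w * x"]) (auto intro: R simp: uv w)
    have "qc_cong 2 ((x ^ 2) ^ 4) (of_int v ^ 4)" by (intro qc_cong_power 1 R)
    also have "qc_cong 2 (of_int v ^ 4) (of_int v)" by (rule v) simp
    also have "qc_cong 2 (of_int v) (x ^ 2)" by (rule qc_cong_sym[OF 1])
    finally show ?thesis by simp
  next
    case False
    then obtain w where w: "u = 2 * w + 1" by (elim oddE)
    have 1: "qc_cong 2 (x ^ 2) (x + of_int v)"
      by (rule qc_congI[of "of_int w * x"]) (auto intro: R simp: uv w algebra_simps)
    have "qc_cong 2 ((x ^ 2) ^ 2) ((x + of_int v) ^ 2)" by (intro qc_cong_power 1 R)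
    also have "qc_cong 2 ((x + of_int v) ^ 2) (x ^ 2 + of_int v ^ 2)" by (intro qc_cong_frobenius_2 R)
    also have "qc_cong 2 (x ^ 2 + of_int v ^ 2) ((x + of_int v) + of_int v)" by (intro qc_cong_add 1 v) simp
    also have "qc_cong 2 ((x + of_int v) + of_int v) x" by (rule qc_congI[of "of_int v"]) (auto intro: R)
    finally have "qc_cong 2 (((x ^ 2) ^ 2) ^ 2) (x ^ 2)" by (intro qc_cong_power R)
    then show ?thesis by simp
  qed
next
  case (add x y)
  note R = quad_compositum.add quad_compositum_power add.hyps
  have "qc_cong 2 ((x + y) ^ 8) (x ^ 8 + y ^ 8)" by (intro qc_cong_frobenius_8 R)
  also have "qc_cong 2 (x ^ 8 + y ^ 8) (x ^ 2 + y ^ 2)" by (intro qc_cong_add add.IH)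
  also have "qc_cong 2 (x ^ 2 + y ^ 2) ((x + y) ^ 2)" by (intro qc_cong_sym[OF qc_cong_frobenius_2] R)
  finally show ?case .
next
  case (mult x y)
  then show ?case unfolding power_mult_distrib by (intro qc_cong_mult quad_compositum_power)
qed (auto intro: qc_cong_refl)

lemma quad_compositum_cong_3_add:
  assumes "x \<in> quad_compositum" "y \<in> quad_compositum" "qc_cong 3 (x ^ 27) (x ^ 3)" "qc_cong 3 (y ^ 27) (y ^ 3)"
  shows "qc_cong 3 ((x + y) ^ 27) ((x + y) ^ 3)"
proof -
  have "qc_cong 3 ((x + y) ^ 27) (x ^ 27 + y ^ 27)" by (intro qc_cong_frobenius_27 assms)
  also have "qc_cong 3 (x ^ 27 + y ^ 27) (x ^ 3 + y ^ 3)" by (intro qc_cong_add assms)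
  also have "qc_cong 3 (x ^ 3 + y ^ 3) ((x + y) ^ 3)" by (intro qc_cong_sym[OF qc_cong_frobenius_3] assms)
  finally show ?thesis .
qed

lemma int_pow_mod_3: "(3 :: int) dvd k ^ 13 - k" "(3 :: int) dvd k ^ 27 - k ^ 3"
proof -
  have p: "k ^ n mod 3 = (k mod 3) ^ n mod 3" for n by (simp add: power_mod)
  consider "k mod 3 = 0" | "k mod 3 = 1" | "k mod 3 = 2" by linarith
  then have "k ^ 13 mod 3 = k mod 3 \<and> k ^ 27 mod 3 = k ^ 3 mod 3"
    unfolding p[of 13] p[of 27] p[of 3] by cases simp_all
  then show "(3 :: int) dvd k ^ 13 - k" "(3 :: int) dvd k ^ 27 - k ^ 3" by (simp_all add: mod_eq_dvd_iff)
qed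

text \<open>Again generators decide. Completing the square gives \<open>y = 2 * x - u\<close> with
  \<open>y ^ 2 = D\<close>, so \<open>y ^ 27 = D ^ 13 * y\<close> and \<open>y ^ 3 = D * y\<close>,
  which agree modulo 3 by Fermat. The exponent 3 instead of 1 on the right is forced by
  \<open>D\<close> divisible by 3, where \<open>y\<close> is only nilpotent.\<close>

lemma quad_compositum_cong_3:
  assumes "x \<in> quad_compositum" shows "qc_cong 3 (x ^ 27) (x ^ 3)"
  using assms
proof (induction rule: quad_compositum.induct)
  case (gen d x)
  then have x: "x \<in> quad_compositum" by (intro quad_compositum.gen)
  note R = quad_compositum.add quad_compositum_power quad_compositum.mult quad_compositum_of_int x quad_compositum_closed
  obtain u v where uv: "x ^ 2 = of_int u * x + of_int v" using quad_int_ring_quadratic gen by metis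
  define y where "y = of_int 2 * x - of_int u"
  define D where "D = u ^ 2 + 4 * v"
  have yR: "y \<in> quad_compositum" unfolding y_def by (intro R)
  have y2: "y ^ 2 = of_int D" 
    unfolding y_def D_def power2_diff power_mult_distrib uv by (simp add: algebra_simps power2_eq_square)
  have i: "qc_cong 3 (of_int k ^ 27) (of_int k ^ 3)" for k
    using qc_cong_of_int[OF int_pow_mod_3(2)[of k]] by simp
  have "qc_cong 3 (of_int D ^ 13 * y) (of_int D * y)"
    using qc_cong_of_int[OF int_pow_mod_3(1)[of D]] by (intro qc_cong_mult qc_cong_refl R yR) simp
  moreover have "of_int D ^ 13 * y = y ^ 27" "of_int D * y = y ^ 3"
    unfolding y2[symmetric] power_mult[symmetric] power_Suc2[symmetric] by simp_all
  ultimately have "qc_cong 3 (y ^ 27) (y ^ 3)" by simp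
  then have "qc_cong 3 ((y + of_int u) ^ 27) ((y + of_int u) ^ 3)"
    by (intro quad_compositum_cong_3_add i yR R)
  then have 2: "qc_cong 3 ((of_int 2 * x) ^ 27) ((of_int 2 * x) ^ 3)" unfolding y_def by simp
  have 4: "qc_cong 3 ((of_int 2 * (of_int 2 * x)) ^ 27) ((of_int 2 * (of_int 2 * x)) ^ 3)"
    unfolding power_mult_distrib[of "of_int 2" "of_int 2 * x"] by (intro qc_cong_mult i 2 R)
  \<comment> \<open>2 is its own inverse modulo 3, which brings the result for \<open>2 * x\<close>
    back to \<open>x\<close>.\<close>
  have c: "qc_cong 3 (of_int 2 * (of_int 2 * x)) x" by (rule qc_congI[OF x]) simp
  have "qc_cong 3 (x ^ 27) ((of_int 2 * (of_int 2 * x)) ^ 27)" by (intro qc_cong_power qc_cong_sym[OF c] R)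
  also note 4
  also have "qc_cong 3 ((of_int 2 * (of_int 2 * x)) ^ 3) (x ^ 3)" by (intro qc_cong_power c R)
  finally show ?case .
next
  case (neg x)
  have "qc_cong 3 ((of_int (-1)) ^ 27 * x ^ 27) ((of_int (-1)) ^ 3 * x ^ 3)"
    by (intro qc_cong_mult neg.IH qc_cong_of_int quad_compositum_power quad_compositum_of_int neg.hyps)
       (auto intro: qc_cong_refl)
  then show ?case by simp
next
  case (add x y)
  then show ?case by (intro quad_compositum_cong_3_add)
next
  case (mult x y)
  then show ?case unfolding power_mult_distrib by (intro qc_cong_mult quad_compositum_power)
qed (auto intro: qc_cong_refl)

section \<open>Chebyshev maps and the lifting of congruences\<close>

definition cheb2 :: "real \<Rightarrow> real" where "cheb2 x = x ^ 2 - 2"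
definition cheb3 :: "real \<Rightarrow> real" where "cheb3 x = x ^ 3 - 3 * x"

lemma cheb_in_quad_compositum:
  assumes "x \<in> quad_compositum" shows "cheb2 x \<in> quad_compositum" "cheb3 x \<in> quad_compositum"
  unfolding cheb2_def cheb3_def
  using quad_compositum_of_int[of 2] quad_compositum_of_int[of 3]
  by (auto intro!: quad_compositum_closed quad_compositum_power quad_compositum.mult assms)

lemma cheb_cos: "cheb2 (2 * cos t) = 2 * cos (2 * t)" "cheb3 (2 * cos t) = 2 * cos (3 * t)"
  unfolding cheb2_def cheb3_def cos_double_cos cos_treble_cos by (simp_all add: power2_eq_square power3_eq_cube)

lemma cheb_le_2:
  assumes "\<bar>x\<bar> \<le> 2" shows "\<bar>cheb2 x\<bar> \<le> 2" "\<bar>cheb3 x\<bar> \<le> 2"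
proof -
  have "x = 2 * cos (arccos (x / 2))" using assms by (simp add: cos_arccos_abs)
  then show "\<bar>cheb2 x\<bar> \<le> 2" "\<bar>cheb3 x\<bar> \<le> 2"
    using cheb_cos[of "arccos (x / 2)"] abs_cos_le_one by (simp_all add: abs_mult)
qed

lemma real_hom_cheb:
  assumes "real_subfield F" "real_hom F \<sigma>" "x \<in> F"
  shows "\<sigma> (cheb2 x) = cheb2 (\<sigma> x)" "\<sigma> (cheb3 x) = cheb3 (\<sigma> x)" "cheb2 x \<in> F" "cheb3 x \<in> F"
proof -
  note c = real_subfield_closed[OF assms(1)] real_subfield_power[OF assms(1)] assms(3)
  have n: "2 \<in> F" "3 \<in> F" "\<sigma> 2 = 2" "\<sigma> 3 = 3" 
    using real_subfield_of_int[OF assms(1), of 2] real_subfield_of_int[OF assms(1), of 3]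
     real_hom_of_int[OF assms(1,2), of 2] real_hom_of_int[OF assms(1,2), of 3] by auto
  show "\<sigma> (cheb2 x) = cheb2 (\<sigma> x)" "\<sigma> (cheb3 x) = cheb3 (\<sigma> x)" "cheb2 x \<in> F" "cheb3 x \<in> F"
    unfolding cheb2_def cheb3_def using c n
    by (simp_all add: real_hom_simps[OF assms(1,2)] real_hom_power[OF assms(1,2)])
qed

text \<open>Modulo 2 the map \<open>cheb2\<close> is squaring, so its third iterate is x ^ 8
  \<equiv> x ^ 2. Two further applications raise the modulus 2 to 8. The unlifted congruence is kept
  because it carries information that the lifted one loses.\<close>

lemma qc_cong_cheb2:
  assumes "x \<in> quad_compositum"
  shows "qc_cong 2 (cheb2 (cheb2 (cheb2 x))) (cheb2 x)"
    and "qc_cong 8 (cheb2 (cheb2 (cheb2 (cheb2 (cheb2 x))))) (cheb2 (cheb2 (cheb2 x)))"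
proof -
  note R = cheb_in_quad_compositum quad_compositum_power assms
  have c: "qc_cong 2 (cheb2 y) (y ^ 2)" for y
    using quad_compositum_of_int[of "-1"] unfolding cheb2_def by (intro qc_congI[of "-1"]) auto
  have "qc_cong 2 (cheb2 (cheb2 x)) ((cheb2 x) ^ 2)" by (rule c)
  also have "qc_cong 2 ((cheb2 x) ^ 2) ((x ^ 2) ^ 2)" by (intro qc_cong_power c R)
  finally have 4: "qc_cong 2 (cheb2 (cheb2 x)) (x ^ 4)" by simp
  have "qc_cong 2 (cheb2 (cheb2 (cheb2 x))) ((cheb2 (cheb2 x)) ^ 2)" by (rule c)
  also have "qc_cong 2 ((cheb2 (cheb2 x)) ^ 2) ((x ^ 4) ^ 2)" by (intro qc_cong_power 4 R)
  also have "(x ^ 4) ^ 2 = x ^ 8" by simp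
  also have "qc_cong 2 (x ^ 8) (x ^ 2)" by (intro quad_compositum_cong_2 R)
  also have "qc_cong 2 (x ^ 2) (cheb2 x)" by (rule qc_cong_sym[OF c])
  finally show 2: "qc_cong 2 (cheb2 (cheb2 (cheb2 x))) (cheb2 x)" .
  \<comment> \<open>In the square of \<open>z + m * w\<close> the mixed term has the factor
    \<open>2 * m\<close>, and so has \<open>m ^ 2 * w ^ 2\<close> because \<open>m\<close> is
    even.\<close>
  have step: "qc_cong (2 * m) (cheb2 y) (cheb2 z)" if "qc_cong m y z" "even m" "z \<in> quad_compositum" for y z m
  proof -
    from that(1) obtain w where w: "w \<in> quad_compositum" "y = z + of_int m * w" unfolding qc_cong_def by blast
    from that(2) obtain l where l: "m = 2 * l" by (elim evenE)
    have "cheb2 y = cheb2 z + of_int (2 * m) * (w * z + of_int l * w ^ 2)"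
      unfolding cheb2_def w(2) l by (simp add: algebra_simps power2_eq_square)
    then show ?thesis
      by (rule qc_congI[rotated])
        (intro quad_compositum.add quad_compositum.mult quad_compositum_of_int w that quad_compositum_power)
  qed
  have 44: "qc_cong (2 * 2) (cheb2 (cheb2 (cheb2 (cheb2 x)))) (cheb2 (cheb2 x))" by (intro step 2 R) simp
  have "qc_cong (2 * (2 * 2)) (cheb2 (cheb2 (cheb2 (cheb2 (cheb2 x))))) (cheb2 (cheb2 (cheb2 x)))"
    by (rule step[OF 44]) (auto intro: R)
  then show "qc_cong 8 (cheb2 (cheb2 (cheb2 (cheb2 (cheb2 x))))) (cheb2 (cheb2 (cheb2 x)))" by simp
qed

text \<open>The same with cubing modulo 3. The derivative of \<open>cheb3\<close> is divisible by 3,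
  so a single application raises the modulus from 3 to 9.\<close>

lemma qc_cong_cheb3:
  assumes "x \<in> quad_compositum"
  shows "qc_cong 9 (cheb3 (cheb3 (cheb3 (cheb3 x)))) (cheb3 (cheb3 x))"
proof -
  note R = cheb_in_quad_compositum quad_compositum_power assms
  have c: "qc_cong 3 (cheb3 y) (y ^ 3)" if "y \<in> quad_compositum" for y
    using quad_compositum.neg[OF that] unfolding cheb3_def by (intro qc_congI[of "-y"]) auto
  have "qc_cong 3 (cheb3 (cheb3 x)) ((cheb3 x) ^ 3)" by (intro c R)
  also have "qc_cong 3 ((cheb3 x) ^ 3) ((x ^ 3) ^ 3)" by (intro qc_cong_power c R)
  finally have 9: "qc_cong 3 (cheb3 (cheb3 x)) (x ^ 9)" by simp
  have "qc_cong 3 (cheb3 (cheb3 (cheb3 x))) ((cheb3 (cheb3 x)) ^ 3)" by (intro c R)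
  also have "qc_cong 3 ((cheb3 (cheb3 x)) ^ 3) ((x ^ 9) ^ 3)" by (intro qc_cong_power 9 R)
  also have "(x ^ 9) ^ 3 = x ^ 27" by simp
  also have "qc_cong 3 (x ^ 27) (x ^ 3)" by (intro quad_compositum_cong_3 R)
  also have "qc_cong 3 (x ^ 3) (cheb3 x)" by (intro qc_cong_sym[OF c] R)
  finally obtain w where w: "w \<in> quad_compositum" "cheb3 (cheb3 (cheb3 x)) = cheb3 x + of_int 3 * w"
    unfolding qc_cong_def by blast
  define z where "z = cheb3 x"
  have "cheb3 (cheb3 (cheb3 (cheb3 x))) = cheb3 (z + of_int 3 * w)" using w(2) unfolding z_def by simp
  also have "\<dots> = cheb3 z + of_int 9 * (z ^ 2 * w + of_int 3 * (z * w ^ 2) + of_int 3 * w ^ 3 - w)"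
    unfolding cheb3_def by (simp add: algebra_simps power2_eq_square power3_eq_cube)
  finally have "cheb3 (cheb3 (cheb3 (cheb3 x))) = cheb3 z + of_int 9 * (z ^ 2 * w + of_int 3 * (z * w ^ 2) + of_int 3 * w ^ 3 - w)" .
  then show ?thesis unfolding z_def
    by (rule qc_congI[rotated])
      (intro quad_compositum_closed quad_compositum.add quad_compositum.mult quad_compositum_of_int w R)
qed

text \<open>The quotient \<open>z\<close> of the difference by \<open>m\<close> has conjugates of
  size at most 4 / m < 1. It is an algebraic integer as an element of the compositum and lies in
  \<open>F\<close> as a quotient of elements of \<open>F\<close>, so \<open>norm_separated\<close>
  applies.\<close>

lemma qc_cong_imp_eq:
  assumes F: "real_subfield F" "norm_separated F" and x: "x \<in> F" "y \<in> F" and c: "qc_cong m x y" and m: "m > 4"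
    and b: "\<And>\<sigma>. real_hom F \<sigma> \<Longrightarrow> \<bar>\<sigma> x\<bar> \<le> 2" "\<And>\<sigma>. real_hom F \<sigma> \<Longrightarrow> \<bar>\<sigma> y\<bar> \<le> 2"
  shows "x = y"
proof -
  note cl = real_subfield_closed[OF F(1)] real_subfield_of_int[OF F(1)]
  obtain z where z: "z \<in> quad_compositum" "x = y + of_int m * z" using c unfolding qc_cong_def by blast
  have "z = (x - y) / of_int m" using z(2) m by simp
  then have zF: "z \<in> F" using cl x by simp
  have "\<bar>\<sigma> z\<bar> < 1" if \<sigma>: "real_hom F \<sigma>" for \<sigma>
  proof -
    have "\<sigma> x = \<sigma> y + of_int m * \<sigma> z"
      unfolding z(2) using zF x cl by (simp add: real_hom_simps[OF F(1) \<sigma>] real_hom_of_int[OF F(1) \<sigma>])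
    then have "\<bar>of_int m * \<sigma> z\<bar> \<le> 4" using b(1)[OF \<sigma>] b(2)[OF \<sigma>] by linarith
    then have "of_int m * \<bar>\<sigma> z\<bar> \<le> 4" using m by (simp add: abs_mult)
    moreover have "4 < real_of_int m" using m by simp
    ultimately have "of_int m * \<bar>\<sigma> z\<bar> < of_int m * 1" by linarith
    then show ?thesis using m by (subst (asm) mult_less_cancel_left_pos) auto
  qed
  then have "z = 0" using F(2) zF quad_compositum_alg_int[OF z(1)] unfolding norm_separated_def by blast
  then show ?thesis using z by simp
qed

section \<open>From equal cosines to the list of entries\<close>

lemma cos_eq_cosE:
  assumes "cos x = cos (y :: real)"
  obtains k :: int where "x = y + 2 * pi * of_int k \<or> x = - y + 2 * pi * of_int k"
proof -
  have "sin ((x + y) / 2) * sin ((y - x) / 2) = 0" using cos_diff_cos[of x y] assms by simp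
  then have "sin ((x + y) / 2) = 0 \<or> sin ((y - x) / 2) = 0" by simp
  then obtain k :: int where "(x + y) / 2 = of_int k * pi \<or> (y - x) / 2 = of_int k * pi"
    unfolding sin_zero_iff_int2 by blast
  then show ?thesis using that[of k] that[of "- k"] by (auto simp: field_simps)
qed

lemma cos_minus_periodic: "cos (- x + 2 * pi * of_int k) = cos (x :: real)"
proof -
  have "cos (- x + 2 * pi * of_int k) = cos (- x) * 1 - sin (- x) * 0"
    using cos_int_2pin[of k] sin_int_2pin[of k] unfolding cos_add by metis
  then show ?thesis by simp
qed

lemma golden_square: "golden ^ 2 = golden + 1"
  unfolding golden_def by (simp add: power2_eq_square field_simps)

lemma cyclotomic_entry_classification:
  assumes F: "real_subfield F" "norm_separated F" and a: "a \<in> F" "a \<in> quad_compositum"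
    and b: "\<And>\<sigma>. real_hom F \<sigma> \<Longrightarrow> \<bar>\<sigma> a\<bar> \<le> 2"
  shows "a \<in> {0, 1, -1, 2, -2, sqrt 2, - sqrt 2, sqrt 3, - sqrt 3, golden, - golden, 1 - golden, golden - 1}"
proof -
  have id: "real_hom F (\<lambda>x. x)" unfolding real_hom_def by simp
  note h = real_hom_cheb[OF F(1)] real_hom_cheb(3,4)[OF F(1) id] a
  have e2: "cheb2 (cheb2 (cheb2 (cheb2 (cheb2 a)))) = cheb2 (cheb2 (cheb2 a))"
    by (rule qc_cong_imp_eq[OF F _ _ qc_cong_cheb2(2)[OF a(2)]]) (simp_all add: h b cheb_le_2)
  have e3: "cheb3 (cheb3 (cheb3 (cheb3 a))) = cheb3 (cheb3 a)"
    by (rule qc_cong_imp_eq[OF F _ _ qc_cong_cheb3[OF a(2)]]) (simp_all add: h b cheb_le_2)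
  define t where "t = arccos (a / 2)"
  have at: "a = 2 * cos t" using b[OF id] unfolding t_def by (simp add: cos_arccos_abs)
  have "cos (32 * t) = cos (8 * t)" using e2 unfolding at cheb_cos by simp
  then obtain k :: int where k: "24 * t = 2 * pi * of_int k \<or> 40 * t = 2 * pi * of_int k"
    by (rule cos_eq_cosE) auto
  have "cos (81 * t) = cos (9 * t)" using e3 unfolding at cheb_cos by simp
  then obtain l :: int where l: "72 * t = 2 * pi * of_int l \<or> 90 * t = 2 * pi * of_int l"
    by (rule cos_eq_cosE) auto
  \<comment> \<open>Since gcd(40, 72) = 8 divides 24 and gcd(40, 90) = 10, these are the only two
    cases. The combinations \<open>2 * k - l\<close> and \<open>l - 2 * k\<close> below are Bezout
    witnesses.\<close>
  have "(\<exists>j::int. 24 * t = 2 * pi * of_int j) \<or> (\<exists>j::int. 10 * t = 2 * pi * of_int j)"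
  proof (cases "24 * t = 2 * pi * of_int k")
    case False
    then have k: "40 * t = 2 * pi * of_int k" using k by simp
    show ?thesis
    proof (cases "72 * t = 2 * pi * of_int l")
      case True
      have "pi * of_int l = 36 * t" "pi * of_int k = 20 * t" using True k by simp_all
      then have "9 * (pi * of_int k) = 5 * (pi * of_int l)" by linarith
      then have "pi * real_of_int (9 * k) = pi * of_int (5 * l)" by (simp add: mult.left_commute)
      then have "real_of_int (9 * k) = of_int (5 * l)" using pi_neq_zero by (metis mult_left_cancel)
      then have "9 * k = 5 * l" unfolding of_int_eq_iff .
      then have "k = 5 * (2 * k - l)" by simp
      then obtain j where "k = 5 * j" by blast
      then show ?thesis using k by (intro disjI1 exI[of _ "3 * j"]) simp
    next
      case False
      then have "90 * t = 2 * pi * of_int l" using l by simp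
      then have "pi * of_int l = 45 * t" "pi * of_int k = 20 * t" using k by simp_all
      then have "9 * (pi * of_int k) = 4 * (pi * of_int l)" by linarith
      then have "pi * real_of_int (9 * k) = pi * of_int (4 * l)" by (simp add: mult.left_commute)
      then have "real_of_int (9 * k) = of_int (4 * l)" using pi_neq_zero by (metis mult_left_cancel)
      then have "9 * k = 4 * l" unfolding of_int_eq_iff .
      then have "k = 4 * (l - 2 * k)" by simp
      then obtain j where "k = 4 * j" by blast
      then show ?thesis using k by (intro disjI2 exI[of _ j]) simp
    qed
  qed blast
  then show ?thesis
  proof (elim disjE exE)
    fix j :: int assume j: "24 * t = 2 * pi * of_int j"
    \<comment> \<open>With 24 = 3 * 8, the value \<open>w8\<close> = 2 cos 8t belongs to an angle of
      order dividing 3. Three half-angle steps x ^ 2 = 2 + \<open>cheb2 x\<close> then lead back to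
      \<open>a\<close>.\<close>
    define b where "b = cheb2 a"
    define w4 where "w4 = cheb2 b"
    define w8 where "w8 = cheb2 w4"
    have "cos (16 * t) = cos (- (8 * t) + 2 * pi * of_int j)" using j by (intro arg_cong[of _ _ cos]) simp
    also have "\<dots> = cos (8 * t)" by (rule cos_minus_periodic)
    finally have "cheb2 w8 = w8" unfolding w8_def w4_def b_def at cheb_cos by simp
    then have "(w8 - 2) * (w8 + 1) = 0" unfolding cheb2_def by (simp add: algebra_simps power2_eq_square)
    then have w8: "w8 = 2 \<or> w8 = -1" by auto
    \<comment> \<open>excludes \<open>a ^ 2 = 2 \<plusminus> sqrt 3\<close>\<close>
    have "z \<notin> quad_compositum" if "b ^ 2 = 3" "w8 = b + of_int 2 * z" for z
    proof
      assume z: "z \<in> quad_compositum"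
      have "w8 = -1" unfolding w8_def w4_def cheb2_def that(1) by simp
      then have z2: "z = - (1 + b) / 2" using that(2) by simp
      \<comment> \<open>This is (b ^ 2 - 1) / 4, not an algebraic integer.\<close>
      have "z * z + z = 1 / 2" unfolding z2 using that(1) by (simp add: field_simps power2_eq_square)
      moreover have "alg_int (z * z + z)" using z
        by (intro quad_compositum_alg_int quad_compositum.add quad_compositum.mult)
      ultimately have "alg_int (1 / 2)" by metis
      then have "1 / 2 \<in> (\<int> :: real set)" by (rule alg_int_rat_imp_int) simp
      then obtain i where "1 / 2 = real_of_int i" by (elim Ints_cases)
      then have "real_of_int (2 * i) = real_of_int 1" by simp
      then have "2 * i = 1" unfolding of_int_eq_iff .
      then show False by presburger
    qed
    \<comment> \<open>\<open>e2\<close> and \<open>e3\<close> hold at t = pi/12 as well, so this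
      case needs the congruence modulo 2 itself.\<close>
    then have b3: "b ^ 2 \<noteq> 3" 
      using qc_cong_cheb2(1)[OF a(2)] unfolding qc_cong_def b_def[symmetric] w4_def[symmetric] w8_def[symmetric] by blast
    have w4: "w4 ^ 2 = 2 + w8" unfolding w8_def cheb2_def by simp
    have bb: "b ^ 2 = 2 + w4" unfolding w4_def cheb2_def by simp
    have aa: "a ^ 2 = 2 + b" unfolding b_def cheb2_def by simp
    have "w4 = 2 \<or> w4 = -2 \<or> w4 = 1 \<or> w4 = -1"
      using w8 w4 power2_eq_iff[of w4 2] power2_eq_iff[of w4 1] by auto
    then have "b = 2 \<or> b = -2 \<or> b = 0 \<or> b = 1 \<or> b = -1"
      using bb b3 power2_eq_iff[of b 2] power2_eq_iff[of b 1] by auto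
    then have "a ^ 2 \<in> {4, 0, 2, 3, 1}" using aa by auto
    then show ?thesis
      using power2_eq_iff[of a 2] power2_eq_iff[of a 1] power2_eq_iff[of a "sqrt 2"] power2_eq_iff[of a "sqrt 3"]
      by auto
  next
    fix j :: int assume j: "10 * t = 2 * pi * of_int j"
    \<comment> \<open>Here 8t and -2t agree modulo 2 pi, so \<open>w\<close> is fixed by the second
      iterate of \<open>cheb2\<close>. The factor \<open>w * w + w - 1\<close> belongs to angles of
      order 5 and is a quartic in \<open>a\<close> with roots \<plusminus>\<phi>, \<plusminus>(1 -
      \<phi>).\<close>
    define w where "w = cheb2 a"
    have "cos (8 * t) = cos (- (2 * t) + 2 * pi * of_int j)" using j by (intro arg_cong[of _ _ cos]) simp
    also have "\<dots> = cos (2 * t)" by (rule cos_minus_periodic)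
    finally have "cheb2 (cheb2 w) = w" unfolding w_def at cheb_cos by simp
    then have "(w - 2) * (w + 1) * (w * w + w - 1) = 0" unfolding cheb2_def by (simp add: algebra_simps power2_eq_square)
    then have "w = 2 \<or> w = -1 \<or> w * w + w - 1 = 0" by auto
    moreover have aa: "a ^ 2 = 2 + w" unfolding w_def cheb2_def by simp
    moreover have "a = golden \<or> a = - golden \<or> a = 1 - golden \<or> a = golden - 1" if "w * w + w - 1 = 0"
    proof -
      have w: "w = a ^ 2 - 2" using aa by simp
      have "(a - golden) * (a - 1 + golden) * ((a + golden) * (a + 1 - golden)) = 
         (a ^ 2 - a + golden - golden ^ 2) * (a ^ 2 + a + golden - golden ^ 2)"
        by (simp add: algebra_simps power2_eq_square)
      also have "\<dots> = w * w + w - 1" unfolding golden_square w by (simp add: algebra_simps power2_eq_square)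
      also have "\<dots> = 0" by (rule that)
      finally show ?thesis by auto
    qed
    ultimately show ?thesis using power2_eq_iff[of a 2] power2_eq_iff[of a 1] by auto
  qed
qed

section \<open>Conjugates and the bilinear bound\<close>

lemma real_hom_det:
  assumes F: "real_subfield F" "real_hom F \<sigma>" and A: "A \<in> carrier_mat n n"
    and e: "\<And>i j. i < n \<Longrightarrow> j < n \<Longrightarrow> A $$ (i, j) \<in> F"
  shows "\<sigma> (det A) = det (map_mat \<sigma> A)"
proof -
  note s = real_hom_simps[OF F]
  have sgn: "signof p \<in> F \<and> \<sigma> (signof p) = signof p" for p :: "nat \<Rightarrow> nat"
    using signof_pm_one[of p, where 'a = real] real_subfield_closed(1,2,3)[OF F(1)] s by auto
  have pr: "(\<Prod>i = 0..<n. A $$ (i, p i)) \<in> F" "\<sigma> (\<Prod>i = 0..<n. A $$ (i, p i)) = (\<Prod>i = 0..<n. map_mat \<sigma> A $$ (i, p i))"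
    if "p permutes {0..<n}" for p
  proof -
    have m: "A $$ (i, p i) \<in> F" "p i < n" if "i \<in> {0..<n}" for i
      using permutes_in_image[OF \<open>p permutes {0..<n}\<close>, of i] that e by auto
    show "(\<Prod>i = 0..<n. A $$ (i, p i)) \<in> F" by (intro real_subfield_prod[OF F(1)] m)
    show "\<sigma> (\<Prod>i = 0..<n. A $$ (i, p i)) = (\<Prod>i = 0..<n. map_mat \<sigma> A $$ (i, p i))"
      by (subst real_hom_prod[OF F m(1)]) (use m A in \<open>auto intro!: prod.cong\<close>)
  qed
  have "\<sigma> (det A) = (\<Sum>p | p permutes {0..<n}. \<sigma> (signof p * (\<Prod>i = 0..<n. A $$ (i, p i))))"
    unfolding det_def'[OF A] by (rule real_hom_sum[OF F]) (use pr sgn real_subfield_closed(6)[OF F(1)] in auto)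
  also have "\<dots> = (\<Sum>p | p permutes {0..<n}. signof p * (\<Prod>i = 0..<n. map_mat \<sigma> A $$ (i, p i)))"
    by (intro sum.cong refl) (use pr sgn s(4) in auto)
  also have "\<dots> = det (map_mat \<sigma> A)" using A by (subst det_def'[of _ n]) auto
  finally show ?thesis .
qed

text \<open>\<open>\<sigma>\<close> respects the operations only on \<open>F\<close>, so the
  comparison is made at integer arguments: there the value is the determinant of a matrix over
  \<open>F\<close> and an integer, hence fixed by \<open>\<sigma>\<close>. Infinitely many arguments
  suffice.\<close>

lemma real_hom_char_poly:
  assumes F: "real_subfield F" "real_hom F \<sigma>" and A: "A \<in> carrier_mat n n"
    and e: "\<And>i j. i < n \<Longrightarrow> j < n \<Longrightarrow> A $$ (i, j) \<in> F"
    and c: "\<forall>i. coeff (char_poly A) i \<in> \<int>"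
  shows "char_poly (map_mat \<sigma> A) = char_poly A"
proof -
  let ?S = "map_mat \<sigma> A"
  have S: "?S \<in> carrier_mat n n" using A by simp
  note s = real_hom_simps[OF F] real_hom_of_int[OF F]
  note cl = real_subfield_closed[OF F(1)] real_subfield_of_int[OF F(1)]
  have eq: "poly (char_poly ?S) (of_int t) = poly (char_poly A) (of_int t)" for t :: int
  proof -
    have "poly (char_poly A) (of_int t) \<in> \<int>"
      unfolding poly_altdef using c by (intro Ints_sum Ints_mult Ints_power) auto
    then obtain l where l: "poly (char_poly A) (of_int t) = of_int l" by (elim Ints_cases)
    have m: "- char_matrix A (of_int t) \<in> carrier_mat n n" using A by simp
    have m': "- char_matrix ?S (of_int t) \<in> carrier_mat n n" using S by simp
    have ent: "i < n \<Longrightarrow> j < n \<Longrightarrow> (- char_matrix A (of_int t)) $$ (i, j) =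
        (if i = j then of_int t - A $$ (i, j) else - A $$ (i, j))" for i j
      using A unfolding char_matrix_def by auto
    have ent': "i < n \<Longrightarrow> j < n \<Longrightarrow> (- char_matrix ?S (of_int t)) $$ (i, j) =
        (if i = j then of_int t - \<sigma> (A $$ (i, j)) else - \<sigma> (A $$ (i, j)))" for i j
      using A unfolding char_matrix_def by auto
    have "of_int l = \<sigma> (det (- char_matrix A (of_int t)))"
      using l s(7)[of l] unfolding char_poly_matrix[OF A] by simp
    also have "\<dots> = det (map_mat \<sigma> (- char_matrix A (of_int t)))"
      by (rule real_hom_det[OF F m]) (use ent e cl in auto)
    also have "map_mat \<sigma> (- char_matrix A (of_int t)) = - char_matrix ?S (of_int t)"
    proof (rule eq_matI)
      fix i j assume "i < dim_row (- char_matrix ?S (of_int t))" "j < dim_col (- char_matrix ?S (of_int t))"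
      then have ij: "i < n" "j < n" using carrier_matD[OF m'] by auto
      have "map_mat \<sigma> (- char_matrix A (of_int t)) $$ (i, j) = \<sigma> ((- char_matrix A (of_int t)) $$ (i, j))"
        using carrier_matD[OF m] ij by (intro index_map_mat(1)) auto
      then show "map_mat \<sigma> (- char_matrix A (of_int t)) $$ (i, j) = (- char_matrix ?S (of_int t)) $$ (i, j)"
        unfolding ent[OF ij] ent'[OF ij] using s cl e[OF ij] by (cases "i = j") auto
    qed (use carrier_matD[OF m] carrier_matD[OF m'] in auto)
    also have "det \<dots> = poly (char_poly ?S) (of_int t)" unfolding char_poly_matrix[OF S] ..
    finally show ?thesis using l by simp
  qed
  have "infinite (range (of_nat :: nat \<Rightarrow> real))" by (intro range_inj_infinite) (simp add: inj_on_def)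
  moreover have "range of_nat \<subseteq> {x. poly (char_poly ?S - char_poly A) x = 0}" using eq[of "int _"] by auto
  ultimately have "infinite {x. poly (char_poly ?S - char_poly A) x = 0}" using finite_subset by blast
  then have "char_poly ?S - char_poly A = 0" using poly_roots_finite by blast
  then show ?thesis by simp
qed

lemma cyclotomic_mat_real_hom:
  assumes F: "real_subfield F" "real_hom F \<sigma>" and A: "A \<in> carrier_mat n n"
    and e: "\<And>i j. i < n \<Longrightarrow> j < n \<Longrightarrow> A $$ (i, j) \<in> F"
    and c: "cyclotomic_mat A"
  shows "cyclotomic_mat (map_mat \<sigma> A)"
proof -
  have p: "char_poly (map_mat \<sigma> A) = char_poly A"
    by (rule real_hom_char_poly[OF F A e]) (use c in \<open>auto simp: cyclotomic_mat_def\<close>)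
  have cp: "char_poly (map_mat complex_of_real M) = map_poly complex_of_real (char_poly M)" 
    if "M \<in> carrier_mat n n" for M :: "real mat"
    using of_real_hom.char_poly_hom[OF that] .
  have "eigenvalue (map_mat complex_of_real (map_mat \<sigma> A)) k \<longleftrightarrow> eigenvalue (map_mat complex_of_real A) k" for k
    using eigenvalue_root_char_poly[of "map_mat complex_of_real (map_mat \<sigma> A)" n k]
      eigenvalue_root_char_poly[of "map_mat complex_of_real A" n k] A cp[of A] cp[of "map_mat \<sigma> A"] p by auto
  moreover have "transpose_mat (map_mat \<sigma> A) = map_mat \<sigma> A"
    using c unfolding cyclotomic_mat_def by (metis map_mat_transpose)
  ultimately show ?thesis using c p unfolding cyclotomic_mat_def by auto
qed

section \<open>Operator norm of a symmetric matrix from its spectrum\<close>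

lemma scalar_prod_Cauchy_Schwarz:
  fixes x y :: "real vec"
  assumes "x \<in> carrier_vec n" "y \<in> carrier_vec n"
  shows "(x \<bullet> y)\<^sup>2 \<le> (x \<bullet> x) * (y \<bullet> y)"
proof -
  define p q r where "p = x \<bullet> x" and "q = y \<bullet> y" and "r = x \<bullet> y"
  have S: "p = (\<Sum>i<n. x $ i * x $ i)" "q = (\<Sum>i<n. y $ i * y $ i)" "r = (\<Sum>i<n. x $ i * y $ i)"
    unfolding p_def q_def r_def scalar_prod_def using assms by (auto simp: atLeast0LessThan)
  have "0 \<le> (\<Sum>i<n. (q * x $ i - r * y $ i)\<^sup>2)" by (intro sum_nonneg) simp
  also have "\<dots> = (\<Sum>i<n. q * q * (x $ i * x $ i) - 2 * q * r * (x $ i * y $ i) + r * r * (y $ i * y $ i))"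
    by (intro sum.cong refl) (simp add: power2_eq_square algebra_simps)
  also have "\<dots> = q * q * p - 2 * q * r * r + r * r * q"
    unfolding sum.distrib sum_subtractf sum_distrib_left[symmetric] S[symmetric] ..
  also have "\<dots> = q * (q * p - r\<^sup>2)" by (simp add: power2_eq_square algebra_simps)
  finally have *: "0 \<le> q * (q * p - r\<^sup>2)" .
  have "q \<ge> 0" unfolding S by (intro sum_nonneg) simp
  show ?thesis unfolding p_def[symmetric] q_def[symmetric] r_def[symmetric]
  proof (cases "q = 0")
    case True
    then have "\<forall>i<n. y $ i = 0" unfolding S by (subst (asm) sum_nonneg_eq_0_iff) auto
    then have "r = 0" unfolding S by simp
    then show "r\<^sup>2 \<le> p * q" using True by simp
  next
    case False
    then show "r\<^sup>2 \<le> p * q" using * \<open>q \<ge> 0\<close> by (simp add: zero_le_mult_iff mult.commute)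
  qed
qed

lemma symmetric_adjoint:
  fixes C :: "real mat"
  assumes "C \<in> carrier_mat n n" "transpose_mat C = C" "x \<in> carrier_vec n" "y \<in> carrier_vec n"
  shows "(C *\<^sub>v x) \<bullet> y = x \<bullet> (C *\<^sub>v y)"
  using transpose_vec_mult_scalar[OF assms(1,4,3)] assms(2) by simp

lemma pow_mat_adjoint:
  fixes C :: "real mat"
  assumes C: "C \<in> carrier_mat n n" "transpose_mat C = C" 
  shows "x \<in> carrier_vec n \<Longrightarrow> y \<in> carrier_vec n \<Longrightarrow> (C ^\<^sub>m k *\<^sub>v x) \<bullet> y = x \<bullet> (C ^\<^sub>m k *\<^sub>v y)"
proof (induction k arbitrary: x y)
  case (Suc k)
  have P: "C ^\<^sub>m k \<in> carrier_mat n n" using C by simp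
  have comm: "C * C ^\<^sub>m k = C ^\<^sub>m k * C"
    using C(1) by (induction k) (auto simp: assoc_mult_mat[of _ n n _ n _ n, symmetric])
  have Cx: "C *\<^sub>v x \<in> carrier_vec n" "C ^\<^sub>m k *\<^sub>v y \<in> carrier_vec n"
    by (rule mult_mat_vec_carrier[OF C(1) Suc.prems(1)] mult_mat_vec_carrier[OF P Suc.prems(2)])+
  have "(C ^\<^sub>m Suc k *\<^sub>v x) \<bullet> y = (C ^\<^sub>m k *\<^sub>v (C *\<^sub>v x)) \<bullet> y"
    using assoc_mult_mat_vec[OF P C(1) Suc.prems(1)] by simp
  also have "\<dots> = x \<bullet> (C *\<^sub>v (C ^\<^sub>m k *\<^sub>v y))"
    using Suc.IH[OF Cx(1) Suc.prems(2)] symmetric_adjoint[OF C Suc.prems(1) Cx(2)] by simp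
  also have "C *\<^sub>v (C ^\<^sub>m k *\<^sub>v y) = C ^\<^sub>m Suc k *\<^sub>v y"
    using assoc_mult_mat_vec[OF C(1) P Suc.prems(2)] comm by simp
  finally show ?case .
qed (use C in simp)

text \<open>With \<open>a k = |C ^ k v| ^ 2\<close>, Cauchy-Schwarz gives \<open>(a k) ^ 2 \<le> a 0 * a (2 k)\<close>, so \<open>a 1 > a 0\<close> would force
  unbounded growth, although the powers of \<open>C\<close> are bounded.\<close>

lemma symmetric_contraction:
  fixes C :: "real mat"
  assumes C: "C \<in> carrier_mat n n" "transpose_mat C = C" 
    and ev: "\<And>k. eigenvalue (map_mat complex_of_real C) k \<Longrightarrow> cmod k < 1"
    and v: "v \<in> carrier_vec n"
  shows "(C *\<^sub>v v) \<bullet> (C *\<^sub>v v) \<le> v \<bullet> v"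
proof (cases "n = 0")
  case True
  then show ?thesis using C v by (simp add: scalar_prod_def)
next
  case False
  let ?C = "map_mat complex_of_real C"
  have C': "?C \<in> carrier_mat n n" using C by simp
  have "spectral_radius ?C < 1"
    using spectral_radius_mem_max(1)[OF C'] False ev unfolding spectrum_def by auto
  then obtain c where c: "\<forall>k. norm_bound (?C ^\<^sub>m k) c"
    using spectral_radius_jnf_norm_bound_less_1_upper_triangular[OF C'] by blast
  have P: "C ^\<^sub>m k \<in> carrier_mat n n" for k using C by simp
  have cb: "\<bar>(C ^\<^sub>m k) $$ (i, j)\<bar> \<le> c" if "i < n" "j < n" for i j k
  proof -
    have "?C ^\<^sub>m k = map_mat complex_of_real (C ^\<^sub>m k)" by (rule of_real_hom.mat_hom_pow[OF C(1), symmetric])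
    then have "norm_bound (map_mat complex_of_real (C ^\<^sub>m k)) c" using c by metis
    then show ?thesis
      using that carrier_matD[OF P[of k]] unfolding norm_bound_def index_map_mat(2,3) by force
  qed
  define a where "a = (\<lambda>k. (C ^\<^sub>m k *\<^sub>v v) \<bullet> (C ^\<^sub>m k *\<^sub>v v))"
  have w: "C ^\<^sub>m k *\<^sub>v v \<in> carrier_vec n" for k using P[of k] v by auto
  define S where "S = (\<Sum>j<n. c * \<bar>v $ j\<bar>)"
  have ab: "a k \<le> n * S\<^sup>2" for k
  proof -
    have "\<bar>(C ^\<^sub>m k *\<^sub>v v) $ i\<bar> \<le> S" if "i < n" for i
    proof -
      have "(C ^\<^sub>m k *\<^sub>v v) $ i = (\<Sum>j<n. (C ^\<^sub>m k) $$ (i, j) * v $ j)"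
        using that carrier_matD[OF P[of k]] carrier_vecD[OF v]
        by (subst index_mult_mat_vec) (auto simp: scalar_prod_def atLeast0LessThan)
      also have "\<bar>\<dots>\<bar> \<le> (\<Sum>j<n. \<bar>(C ^\<^sub>m k) $$ (i, j) * v $ j\<bar>)" by (rule sum_abs)
      also have "\<dots> \<le> S" unfolding S_def abs_mult using cb that by (intro sum_mono mult_right_mono) auto
      finally show ?thesis .
    qed
    then have "((C ^\<^sub>m k *\<^sub>v v) $ i)\<^sup>2 \<le> S\<^sup>2" if "i < n" for i
      using that abs_le_square_iff[of "(C ^\<^sub>m k *\<^sub>v v) $ i" S] by fastforce
    then have "(\<Sum>i<n. ((C ^\<^sub>m k *\<^sub>v v) $ i)\<^sup>2) \<le> (\<Sum>i<n. S\<^sup>2)" by (intro sum_mono) auto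
    then show ?thesis unfolding a_def scalar_prod_def carrier_vecD[OF w]
      by (simp only: power2_eq_square atLeast0LessThan) simp
  qed
  have a_nonneg: "a k \<ge> 0" for k unfolding a_def scalar_prod_def by (intro sum_nonneg) simp
  have PP: "C ^\<^sub>m (k + l) = C ^\<^sub>m k * C ^\<^sub>m l" for k l
    by (induction l) (use C P in \<open>auto simp: assoc_mult_mat[of _ n n _ n _ n]\<close>)
  have double: "(a k)\<^sup>2 \<le> a 0 * a (k + k)" for k
  proof -
    have "a k = v \<bullet> (C ^\<^sub>m (k + k) *\<^sub>v v)"
      unfolding a_def pow_mat_adjoint[OF C v w] PP using assoc_mult_mat_vec[OF P P v, of k k] by simp
    moreover have "C ^\<^sub>m 0 *\<^sub>v v = v" using C v by simp
    ultimately show ?thesis unfolding a_def using scalar_prod_Cauchy_Schwarz[OF v w[of "k + k"]] by simp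
  qed
  have a01: "a 0 = v \<bullet> v" "a 1 = (C *\<^sub>v v) \<bullet> (C *\<^sub>v v)" unfolding a_def using C v by simp_all
  show ?thesis unfolding a01[symmetric]
  proof (rule ccontr)
    assume "\<not> a 1 \<le> a 0"
    then have lt: "a 0 < a 1" by simp
    have a0: "a 0 > 0" using double[of 1] lt a_nonneg[of 0] by (cases "a 0 = 0") auto
    define t where "t = a 1 / a 0"
    have t: "t > 1" unfolding t_def using lt a0 by simp
    \<comment> \<open>Only exponents that are powers of two are reached: \<open>double\<close>
      doubles the exponent and squares the ratio to \<open>a 0\<close>.\<close>
    have g: "a 0 * t ^ (2 ^ m) \<le> a (2 ^ m)" for m
    proof (induction m)
      case (Suc m)
      have "(a 0 * t ^ (2 ^ m))\<^sup>2 \<le> (a (2 ^ m))\<^sup>2" using Suc a0 t by (intro power_mono) auto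
      also have "\<dots> \<le> a 0 * a (2 ^ m + 2 ^ m)" by (rule double)
      also have "2 ^ m + 2 ^ m = (2 :: nat) ^ Suc m" by simp
      finally have "a 0 * (a 0 * t ^ (2 ^ Suc m)) \<le> a 0 * a (2 ^ Suc m)"
        by (simp add: power2_eq_square power_add mult_2 algebra_simps)
      then show ?case using a0 by simp
    qed (use a0 in \<open>simp add: t_def\<close>)
    obtain N :: nat where N: "n * S\<^sup>2 / a 0 < t ^ N" using real_arch_pow[OF t] by blast
    have "t ^ N \<le> t ^ (2 ^ N)" using t by (intro power_increasing) (auto intro: less_imp_le less_exp)
    then have "n * S\<^sup>2 < a 0 * t ^ (2 ^ N)" using N a0 by (simp add: field_simps) (smt (verit) mult_left_mono)
    then show False using g[of N] ab[of "2 ^ N"] by linarith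
  qed
qed

lemma smult_mat_mult_vec:
  assumes "A \<in> carrier_mat m n" "v \<in> carrier_vec n"
  shows "(c \<cdot>\<^sub>m A) *\<^sub>v v = c \<cdot>\<^sub>v (A *\<^sub>v (v :: 'a :: comm_semiring_0 vec))"
  using assms by (intro eq_vecI) (auto simp: scalar_prod_def sum_distrib_left mult.assoc)

text \<open>\<open>B\<close> has operator norm at most 2, stated without square roots: u . z \<le>
  |u|^2 + |z|^2 / 4 for z = B w. Since \<open>symmetric_contraction\<close> wants eigenvalues
  strictly inside the unit disc, it is applied to B / s for s > 2, and s tends to 2. Independent
  \<open>u\<close> and \<open>w\<close> permit different supports later.\<close>

lemma cyclotomic_bilinear_bound:
  assumes B: "B \<in> carrier_mat n n" "cyclotomic_mat B"
  shows "(\<Sum>i<n. \<Sum>j<n. u i * B $$ (i, j) * w j) \<le> (\<Sum>i<n. (u i)\<^sup>2) + (\<Sum>i<n. (w i)\<^sup>2)"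
proof -
  define v where "v = vec n w"
  have v: "v \<in> carrier_vec n" unfolding v_def by simp
  define z where "z = B *\<^sub>v v"
  have z: "z \<in> carrier_vec n" unfolding z_def using B v by auto
  have scaled: "z \<bullet> z \<le> s\<^sup>2 * (v \<bullet> v)" if s: "s > 2" for s :: real
  proof -
    define C where "C = (1 / s) \<cdot>\<^sub>m B"
    have C: "C \<in> carrier_mat n n" "transpose_mat C = C"
    proof -
      show "C \<in> carrier_mat n n" unfolding C_def using B by simp
      have "transpose_mat B = B" using B(2) unfolding cyclotomic_mat_def by blast
      moreover have "transpose_mat C = (1 / s) \<cdot>\<^sub>m transpose_mat B" unfolding C_def by (rule eq_matI) auto
      ultimately show "transpose_mat C = C" unfolding C_def by simp
    qed
    have "cmod k < 1" if ek: "eigenvalue (map_mat complex_of_real C) k" for k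
    proof -
      obtain x where x: "x \<in> carrier_vec n" "x \<noteq> 0\<^sub>v n" "map_mat complex_of_real C *\<^sub>v x = k \<cdot>\<^sub>v x"
        using ek C(1) unfolding eigenvalue_def eigenvector_def by auto
      have "map_mat complex_of_real B = complex_of_real s \<cdot>\<^sub>m map_mat complex_of_real C"
        unfolding C_def using s by (intro eq_matI) auto
      then have "map_mat complex_of_real B *\<^sub>v x = complex_of_real s \<cdot>\<^sub>v (k \<cdot>\<^sub>v x)"
        using x C(1) smult_mat_mult_vec[of "map_mat complex_of_real C" n n x] by auto
      then have "eigenvalue (map_mat complex_of_real B) (complex_of_real s * k)"
        using x B(1) unfolding eigenvalue_def eigenvector_def by (auto simp: smult_smult_assoc)
      then obtain r where r: "-2 \<le> r" "r \<le> 2" "complex_of_real s * k = complex_of_real r"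
        using B(2) unfolding cyclotomic_mat_def by blast
      have "s * cmod k = \<bar>r\<bar>" using r(3) s by (metis norm_mult norm_of_real abs_of_pos less_trans zero_less_numeral)
      then have "s * cmod k < s * 1" using r s by linarith
      then show ?thesis using s by (subst (asm) mult_less_cancel_left_pos) auto
    qed
    then have "(C *\<^sub>v v) \<bullet> (C *\<^sub>v v) \<le> v \<bullet> v" by (rule symmetric_contraction[OF C _ v])
    moreover have "C *\<^sub>v v = (1 / s) \<cdot>\<^sub>v z" unfolding C_def z_def using smult_mat_mult_vec[OF B(1) v] by simp
    ultimately have "(1 / s) * ((1 / s) * (z \<bullet> z)) \<le> v \<bullet> v" using z by simp
    then show ?thesis using s by (simp add: field_simps power2_eq_square)
  qed
  have zz: "z \<bullet> z \<le> 4 * (v \<bullet> v)"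
  proof (rule tendsto_lowerbound)
    show "((\<lambda>s. s\<^sup>2 * (v \<bullet> v)) \<longlongrightarrow> 4 * (v \<bullet> v)) (at_right (2 :: real))"
      by (auto intro!: tendsto_eq_intros)
    show "\<forall>\<^sub>F s in at_right (2 :: real). z \<bullet> z \<le> s\<^sup>2 * (v \<bullet> v)"
      using scaled eventually_at_right_less by (rule eventually_mono[rotated])
  qed simp
  have zi: "z $ i = (\<Sum>j<n. B $$ (i, j) * w j)" if "i < n" for i
    unfolding z_def v_def using that B(1) by (simp add: scalar_prod_def atLeast0LessThan)
  have "(\<Sum>i<n. \<Sum>j<n. u i * B $$ (i, j) * w j) = (\<Sum>i<n. u i * z $ i)"
    by (intro sum.cong refl) (simp add: zi sum_distrib_left mult.assoc)
  also have "\<dots> \<le> (\<Sum>i<n. (u i)\<^sup>2 + (z $ i)\<^sup>2 / 4)"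
  proof (intro sum_mono)
    fix i
    have "0 \<le> (u i - z $ i / 2)\<^sup>2" by simp
    then show "u i * z $ i \<le> (u i)\<^sup>2 + (z $ i)\<^sup>2 / 4" by (simp add: power2_eq_square algebra_simps)
  qed
  also have "\<dots> = (\<Sum>i<n. (u i)\<^sup>2) + (z \<bullet> z) / 4"
    unfolding sum.distrib sum_divide_distrib[symmetric] scalar_prod_def using z by (simp add: power2_eq_square atLeast0LessThan)
  also have "(z \<bullet> z) / 4 \<le> (\<Sum>i<n. (w i)\<^sup>2)"
    using zz unfolding v_def by (simp add: scalar_prod_def power2_eq_square atLeast0LessThan)
  finally show ?thesis by simp
qed

section \<open>Heavy paths\<close>

text \<open>Restricting the two arguments of the bilinear form to the vertices of even and of odd position
  removes diagonal entries and chords between positions of equal parity.\<close>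

lemma parity_test_vector:
  fixes B :: "nat \<Rightarrow> nat \<Rightarrow> real" and c :: "nat \<Rightarrow> real"
  assumes bound: "\<And>u w. (\<Sum>i<n. \<Sum>j<n. u i * B i j * w j) \<le> (\<Sum>i<n. (u i)\<^sup>2) + (\<Sum>i<n. (w i)\<^sup>2)"
    and fin: "finite E" "finite D" and inj: "inj_on y E" "inj_on y D"
    and y: "\<And>r. r \<in> E \<union> D \<Longrightarrow> y r < n"
  shows "(\<Sum>r\<in>E. \<Sum>s\<in>D. c r * c s * B (y r) (y s)) \<le> (\<Sum>r\<in>E. (c r)\<^sup>2) + (\<Sum>r\<in>D. (c r)\<^sup>2)"
proof -
  define g where "g = (\<lambda>X i. if i \<in> y ` X then c (inv_into X y i) else 0)"
  have g: "g X (y r) = c r" if "inj_on y X" "r \<in> X" for X r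
    unfolding g_def using that by (simp add: inv_into_f_f)
  have S: "(\<Sum>i<n. h i * g X i) = (\<Sum>r\<in>X. h (y r) * c r)" 
    if X: "inj_on y X" "\<And>r. r \<in> X \<Longrightarrow> y r < n" "finite X" for X and h :: "nat \<Rightarrow> real"
  proof -
    have "(\<Sum>i<n. h i * g X i) = (\<Sum>i\<in>y ` X. h i * g X i)"
      by (rule sum.mono_neutral_right) (use X in \<open>auto simp: g_def\<close>)
    also have "\<dots> = (\<Sum>r\<in>X. h (y r) * g X (y r))" using X(1) by (simp add: sum.reindex)
    also have "\<dots> = (\<Sum>r\<in>X. h (y r) * c r)" by (intro sum.cong refl) (simp add: g[OF X(1)])
    finally show ?thesis .
  qed
  have Q: "(\<Sum>i<n. (g X i)\<^sup>2) = (\<Sum>r\<in>X. (c r)\<^sup>2)" 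
    if X: "inj_on y X" "\<And>r. r \<in> X \<Longrightarrow> y r < n" "finite X" for X
    using S[OF X, where h = "g X"] g[OF X(1)] by (simp add: power2_eq_square)
  have E: "\<And>r. r \<in> E \<Longrightarrow> y r < n" and D: "\<And>r. r \<in> D \<Longrightarrow> y r < n" using y by auto
  have "(\<Sum>i<n. \<Sum>j<n. g E i * B i j * g D j) = (\<Sum>i<n. (\<Sum>s\<in>D. B i (y s) * c s) * g E i)"
  proof (intro sum.cong refl)
    fix i
    have "(\<Sum>j<n. g E i * B i j * g D j) = (\<Sum>s\<in>D. g E i * B i (y s) * c s)"
      by (rule S[OF inj(2) D fin(2)])
    then show "(\<Sum>j<n. g E i * B i j * g D j) = (\<Sum>s\<in>D. B i (y s) * c s) * g E i"
      by (simp add: sum_distrib_left sum_distrib_right mult_ac)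
  qed
  also have "\<dots> = (\<Sum>r\<in>E. (\<Sum>s\<in>D. B (y r) (y s) * c s) * c r)" by (rule S[OF inj(1) E fin(1)])
  also have "\<dots> = (\<Sum>r\<in>E. \<Sum>s\<in>D. c r * c s * B (y r) (y s))"
    by (simp add: sum_distrib_left sum_distrib_right mult_ac)
  finally show ?thesis using bound[of "g E" "g D"] Q[OF inj(1) E fin(1)] Q[OF inj(2) D fin(2)] by simp
qed

text \<open>Switching signs: rescaling the vertices by them makes every consecutive edge of the path
  contribute nonnegatively.\<close>

primrec path_sign :: "(nat \<Rightarrow> nat \<Rightarrow> real) \<Rightarrow> (nat \<Rightarrow> nat) \<Rightarrow> nat \<Rightarrow> real" where
  "path_sign B y 0 = 1"
| "path_sign B y (Suc r) = path_sign B y r * sgn (B (y r) (y (Suc r)))"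

text \<open>The test vector is the null vector (1, sqrt 2, ..., sqrt 2, 1) of the affine diagram
  of type C, i.e. of a path with edge weights sqrt 2, 1, ..., 1, sqrt 2.\<close>

lemma no_heavy_path:
  fixes B :: "nat \<Rightarrow> nat \<Rightarrow> real"
  assumes bound: "\<And>u w. (\<Sum>i<n. \<Sum>j<n. u i * B i j * w j) \<le> (\<Sum>i<n. (u i)\<^sup>2) + (\<Sum>i<n. (w i)\<^sup>2)"
    and sym: "\<And>i j. i < n \<Longrightarrow> j < n \<Longrightarrow> B i j = B j i"
    and m: "m \<ge> 2" and y: "\<And>r. r \<le> m \<Longrightarrow> y r < n"
    and dist: "\<And>r s. r < s \<Longrightarrow> s \<le> m \<Longrightarrow> even (s - r) \<Longrightarrow> y r \<noteq> y s"
    and first: "\<bar>B (y 0) (y 1)\<bar> \<ge> sqrt 2" and last: "\<bar>B (y (m - 1)) (y m)\<bar> \<ge> sqrt 2"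
    and strict: "\<bar>B (y 0) (y 1)\<bar> > sqrt 2 \<or> \<bar>B (y (m - 1)) (y m)\<bar> > sqrt 2"
    and mid: "\<And>r. 0 < r \<Longrightarrow> Suc r < m \<Longrightarrow> \<bar>B (y r) (y (Suc r))\<bar> \<ge> 1"
    and extra: "\<And>r s. r < s \<Longrightarrow> s \<le> m \<Longrightarrow> odd (s - r) \<Longrightarrow> Suc r \<noteq> s \<Longrightarrow>
        path_sign B y r * path_sign B y s * B (y r) (y s) \<ge> 0"
  shows False
proof -
  define g where "g = path_sign B y"
  have gs: "g (Suc r) = g r * sgn (B (y r) (y (Suc r)))" for r unfolding g_def by simp
  have ne: "B (y r) (y (Suc r)) \<noteq> 0" if "r < m" for r
  proof -
    have "sqrt 2 > 0" by simp
    from that consider "r = 0" | "r = m - 1" | "0 < r" "Suc r < m" by linarith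
    then show ?thesis using first last mid[of r] m \<open>sqrt 2 > 0\<close> by cases auto
  qed
  have g1: "g r * g r = 1" if "r \<le> m" for r
    using that by (induction r) (use ne in \<open>auto simp: gs g_def[THEN fun_cong] sgn_if\<close>)
  have edge: "g r * g (Suc r) * B (y r) (y (Suc r)) = \<bar>B (y r) (y (Suc r))\<bar>" if "r < m" for r
    unfolding gs using g1[of r] that
    by (simp add: mult.assoc[symmetric] sgn_mult_self_eq abs_sgn mult.commute)
  define k where "k = (\<lambda>r. if r = 0 \<or> r = m then 1 else sqrt 2 :: real)"
  have k0: "k r \<ge> 0" for r unfolding k_def by simp
  define c where "c = (\<lambda>r. g r * k r)"
  define E D where "E = {r. r \<le> m \<and> even r}" and "D = {r. r \<le> m \<and> odd r}"
  have ED: "finite E" "finite D" "E \<inter> D = {}" "E \<union> D = {..m}" unfolding E_def D_def by auto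
  have inj_X: "inj_on y X" if X: "\<And>r s. r \<in> X \<Longrightarrow> s \<in> X \<Longrightarrow> s \<le> m \<and> even (r + s)" for X
  proof (rule inj_onI, rule ccontr)
    fix r s assume a: "r \<in> X" "s \<in> X" "y r = y s" "r \<noteq> s"
    then have "s \<le> m" "r \<le> m" "even (s + r)" using X[OF a(1,2)] X[OF a(2,1)] by auto
    moreover from a(4) consider "r < s" | "s < r" by linarith
    ultimately show False using dist[of r s] dist[of s r] a(3) by cases (auto simp: add.commute)
  qed
  \<comment> \<open>A vertex may still occur both in an even and in an odd position, because the two
    classes enter different arguments of the form.\<close>
  have inj: "inj_on y E" "inj_on y D" by (rule inj_X; auto simp: E_def D_def)+
  define f where "f = (\<lambda>r s. c r * c s * B (y r) (y s))"
  have fsym: "f r s = f s r" if "r \<le> m" "s \<le> m" for r s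
    unfolding f_def using sym[of "y r" "y s"] y that by simp
  have fedge: "f r (Suc r) = k r * k (Suc r) * \<bar>B (y r) (y (Suc r))\<bar>" if "r < m" for r
    unfolding f_def c_def using edge[OF that] by (simp add: mult_ac)
  have fpos: "f r s \<ge> 0" if rs: "r < s" "s \<le> m" "odd (s - r)" for r s
  proof (cases "Suc r = s")
    case True
    then show ?thesis using fedge[of r] rs k0 by auto
  next
    case False
    have "f r s = (k r * k s) * (g r * g s * B (y r) (y s))" unfolding f_def c_def by (simp add: mult_ac)
    then show ?thesis using extra[OF rs False] k0 unfolding g_def[symmetric] by simp
  qed
  have fnn: "f r s \<ge> 0" if "r \<in> E" "s \<in> D" for r s
  proof (cases "r < s")
    case True
    then show ?thesis using fpos[of r s] that unfolding E_def D_def by auto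
  next
    case False
    then have "s < r" using that unfolding E_def D_def by (cases "s = r") auto
    then show ?thesis using fpos[of s r] fsym[of r s] that unfolding E_def D_def by auto
  qed
  \<comment> \<open>Lists each path edge once, even end first, as a pair in E x D. The other pairs
    there contribute nonnegatively by \<open>fnn\<close>.\<close>
  define p where "p = (\<lambda>r::nat. if even r then (r, Suc r) else (Suc r, r))"
  have "(\<Sum>r<m. k r * k (Suc r) * \<bar>B (y r) (y (Suc r))\<bar>) = (\<Sum>r<m. case p r of (a, b) \<Rightarrow> f a b)"
    by (intro sum.cong refl) (use fedge fsym in \<open>auto simp: p_def\<close>)
  also have "\<dots> = (\<Sum>(a, b)\<in>p ` {..<m}. f a b)"
  proof (subst sum.reindex)
    show "inj_on p {..<m}" unfolding p_def inj_on_def by (auto split: if_splits)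
  qed simp
  also have "\<dots> \<le> (\<Sum>(a, b)\<in>E \<times> D. f a b)"
    by (rule sum_mono2) (use fnn in \<open>auto simp: p_def E_def D_def split: if_splits\<close>)
  also have "\<dots> = (\<Sum>r\<in>E. \<Sum>s\<in>D. c r * c s * B (y r) (y s))"
    unfolding f_def by (simp add: sum.cartesian_product)
  also have "\<dots> \<le> (\<Sum>r\<in>E. (c r)\<^sup>2) + (\<Sum>r\<in>D. (c r)\<^sup>2)"
    by (rule parity_test_vector[OF bound ED(1,2) inj]) (use ED(4) y in auto)
  also have "\<dots> = (\<Sum>r\<le>m. (c r)\<^sup>2)" unfolding ED(4)[symmetric] by (rule sum.union_disjoint[symmetric, OF ED(1-3)])
  also have "\<dots> = (\<Sum>r\<le>m. (k r)\<^sup>2)"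
    unfolding c_def by (intro sum.cong refl) (use g1 in \<open>auto simp: power_mult_distrib power2_eq_square\<close>)
  finally have le: "(\<Sum>r<m. k r * k (Suc r) * \<bar>B (y r) (y (Suc r))\<bar>) \<le> (\<Sum>r\<le>m. (k r)\<^sup>2)" .
  \<comment> \<open>\<open>l\<close> counts the inner edges. The squared norm is 2 + 2 (l + 1), and
    the edges contribute at least 2 + 2 l + 2: a tie, which the strictly heavier end breaks.\<close>
  obtain l where l: "m = Suc (Suc l)" using m by (metis add_2_eq_Suc le_Suc_ex)
  have K: "(\<Sum>r\<le>m. (k r)\<^sup>2) = 2 * real l + 4"
  proof -
    have "(\<Sum>r\<le>m. (k r)\<^sup>2) = (k 0)\<^sup>2 + (\<Sum>r\<le>l. (k (Suc r))\<^sup>2) + (k m)\<^sup>2"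
      unfolding l by (subst sum.atMost_Suc_shift) simp
    also have "(\<Sum>r\<le>l. (k (Suc r))\<^sup>2) = (\<Sum>r\<le>l. 2)" by (intro sum.cong refl) (simp add: k_def l)
    finally show ?thesis unfolding k_def by simp
  qed
  have "(\<Sum>r<m. k r * k (Suc r) * \<bar>B (y r) (y (Suc r))\<bar>)
      = k 0 * k 1 * \<bar>B (y 0) (y 1)\<bar> + (\<Sum>r<l. k (Suc r) * k (Suc (Suc r)) * \<bar>B (y (Suc r)) (y (Suc (Suc r)))\<bar>)
        + k (m - 1) * k m * \<bar>B (y (m - 1)) (y m)\<bar>"
    unfolding l by (subst sum.lessThan_Suc_shift) simp
  moreover have "(\<Sum>r<l. 2) \<le> (\<Sum>r<l. k (Suc r) * k (Suc (Suc r)) * \<bar>B (y (Suc r)) (y (Suc (Suc r)))\<bar>)"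
  proof (rule sum_mono)
    fix r assume "r \<in> {..<l}"
    then have "k (Suc r) * k (Suc (Suc r)) = 2" "\<bar>B (y (Suc r)) (y (Suc (Suc r)))\<bar> \<ge> 1"
      using mid[of "Suc r"] l unfolding k_def by auto
    then show "2 \<le> k (Suc r) * k (Suc (Suc r)) * \<bar>B (y (Suc r)) (y (Suc (Suc r)))\<bar>" by simp
  qed
  moreover have "k 0 * k 1 = sqrt 2" "k (m - 1) * k m = sqrt 2" using l unfolding k_def by auto
  moreover have "sqrt 2 * \<bar>B (y 0) (y 1)\<bar> \<ge> sqrt 2 * sqrt 2" "sqrt 2 * \<bar>B (y (m - 1)) (y m)\<bar> \<ge> sqrt 2 * sqrt 2"
    using first last by (simp_all add: mult_left_mono del: real_sqrt_mult_self)
  moreover have "sqrt 2 * \<bar>B (y 0) (y 1)\<bar> > sqrt 2 * sqrt 2 \<or> sqrt 2 * \<bar>B (y (m - 1)) (y m)\<bar> > sqrt 2 * sqrt 2"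
    using strict by (simp del: real_sqrt_mult_self)
  ultimately show False using le K by simp
qed

section \<open>Combining the types\<close>

text \<open>The irrational values grouped by the radicand of their field; each set is closed under
  conjugation and negation.\<close>

definition irr_type :: "nat \<Rightarrow> real set" where
  "irr_type t = (if t = 2 then {sqrt 2, - sqrt 2} else if t = 3 then {sqrt 3, - sqrt 3}
     else if t = 5 then {golden, - golden, 1 - golden, golden - 1} else {})"

text \<open>The largest absolute value among the members of \<open>irr_type t\<close>; it is sqrt 2
  for \<open>t = 2\<close> and larger for 3 and 5.\<close>

definition irr_val :: "nat \<Rightarrow> real" where
  "irr_val t = (if t = 5 then golden else sqrt (real t))"

lemma irr_type_cases: "a \<in> irr_type t \<Longrightarrow> t = 2 \<or> t = 3 \<or> t = 5"
  unfolding irr_type_def by (auto split: if_splits)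

lemma irr_val_bounds: 
  "1.41 < sqrt (2 :: real)" "sqrt (2 :: real) < 1.42" "1.73 < sqrt (3 :: real)" "sqrt (3 :: real) < 1.74"
  "1.6 < golden" "golden < 1.7"
proof -
  show "1.41 < sqrt (2 :: real)" "1.73 < sqrt (3 :: real)" by (rule real_less_rsqrt; simp add: power2_eq_square)+
  show "sqrt (2 :: real) < 1.42" "sqrt (3 :: real) < 1.74" by (rule real_less_lsqrt; simp add: power2_eq_square)+
  have "2.2 < sqrt (5 :: real)" by (rule real_less_rsqrt) (simp add: power2_eq_square)
  moreover have "sqrt (5 :: real) < 2.4" by (rule real_less_lsqrt) (simp_all add: power2_eq_square)
  ultimately show "1.6 < golden" "golden < 1.7" unfolding golden_def by simp_all
qed

lemma irr_type_disjoint: "a \<in> irr_type s \<Longrightarrow> a \<in> irr_type t \<Longrightarrow> s = t"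
  using irr_val_bounds unfolding irr_type_def by (auto split: if_splits)

text \<open>For \<open>t = 5\<close> only one of the two conjugations gives \<open>a\<close> the
  absolute value \<open>golden\<close>, so \<open>a\<close> determines the resulting sign
  \<open>s\<close>. For 2 and 3 both conjugates are equally large, and \<open>s\<close> can be
  prescribed.\<close>

lemma irr_type_conjugate_sign:
  assumes F: "real_subfield F" "sqrt (real t) \<in> F" and a: "a \<in> irr_type t"
  shows "\<exists>e s. e * e = 1 \<and> s * s = (1::real) \<and>
      (\<forall>\<sigma>. real_hom F \<sigma> \<longrightarrow> \<sigma> (sqrt (real t)) = e * sqrt (real t) \<longrightarrow> \<sigma> a = s * irr_val t)"
    and "t \<noteq> 5 \<Longrightarrow> s * s = 1 \<Longrightarrow> \<exists>e. e * e = 1 \<and>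
      (\<forall>\<sigma>. real_hom F \<sigma> \<longrightarrow> \<sigma> (sqrt (real t)) = e * sqrt (real t) \<longrightarrow> \<sigma> a = s * irr_val t)"
proof -
  show 2: "\<exists>e. e * e = 1 \<and>
      (\<forall>\<sigma>. real_hom F \<sigma> \<longrightarrow> \<sigma> (sqrt (real t)) = e * sqrt (real t) \<longrightarrow> \<sigma> a = s * irr_val t)"
    if "t \<noteq> 5" "s * s = 1" for s
  proof -
    have "a = sqrt (real t) \<or> a = - sqrt (real t)"
      using a that(1) unfolding irr_type_def by (auto split: if_splits)
    then show ?thesis
    proof
      assume "a = sqrt (real t)"
      then show ?thesis using that unfolding irr_val_def by (intro exI[of _ s]) auto
    next
      assume "a = - sqrt (real t)"
      then have "\<sigma> a = s * irr_val t" if "real_hom F \<sigma>" "\<sigma> (sqrt (real t)) = - s * sqrt (real t)" for \<sigma>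
        using that \<open>t \<noteq> 5\<close> real_hom_simps(5)[OF F(1) that(1) F(2)] unfolding irr_val_def by simp
      then show ?thesis using that(2) by (intro exI[of _ "- s"]) auto
    qed
  qed
  show "\<exists>e s. e * e = 1 \<and> s * s = (1::real) \<and>
      (\<forall>\<sigma>. real_hom F \<sigma> \<longrightarrow> \<sigma> (sqrt (real t)) = e * sqrt (real t) \<longrightarrow> \<sigma> a = s * irr_val t)"
  proof (cases "t = 5")
    case False
    then show ?thesis using 2[of 1] by (metis mult_1)
  next
    case True
    note c = real_subfield_closed[OF F(1)]
    have F5: "sqrt 5 \<in> F" using F(2) True by simp
    have F2: "2 \<in> F" using real_subfield_of_int[OF F(1), of 2] by simp
    have gF: "golden \<in> F" unfolding golden_def using c F5 F2 by auto
    have g: "\<sigma> golden = (1 + e * sqrt 5) / 2" if "real_hom F \<sigma>" "\<sigma> (sqrt 5) = e * sqrt 5" for \<sigma> e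
    proof -
      have "2 * golden = 1 + sqrt 5" unfolding golden_def by simp
      then have "\<sigma> (2 * golden) = \<sigma> (1 + sqrt 5)" by simp
      then have "2 * \<sigma> golden = 1 + e * sqrt 5"
        using real_hom_simps(2,3,4)[OF F(1) that(1)] real_hom_of_int[OF F(1) that(1), of 2] gF F2 F5 c(2) that(2) by simp
      then show ?thesis by simp
    qed
    have gp: "\<sigma> golden = golden" if "real_hom F \<sigma>" "\<sigma> (sqrt 5) = 1 * sqrt 5" for \<sigma>
      using g[OF that] unfolding golden_def by (simp add: add_divide_distrib)
    have gm: "\<sigma> golden = 1 - golden" if "real_hom F \<sigma>" "\<sigma> (sqrt 5) = -1 * sqrt 5" for \<sigma>
      using g[OF that] unfolding golden_def by (simp add: diff_divide_distrib)
    have v: "irr_val t = golden" "sqrt (real t) = sqrt 5" using True unfolding irr_val_def by simp_all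
    have "a = golden \<or> a = - golden \<or> a = 1 - golden \<or> a = golden - 1"
      using a True unfolding irr_type_def by auto
    then consider "a = golden" | "a = - golden" | "a = 1 - golden" | "a = golden - 1" by blast
    then show ?thesis
    proof cases
      case 1
      then have "\<sigma> a = 1 * golden" if "real_hom F \<sigma>" "\<sigma> (sqrt 5) = 1 * sqrt 5" for \<sigma>
        using gp[OF that] by simp
      then show ?thesis unfolding v by (intro exI[of _ 1] exI[of _ 1]) auto
    next
      case 2
      then have "\<sigma> a = -1 * golden" if "real_hom F \<sigma>" "\<sigma> (sqrt 5) = 1 * sqrt 5" for \<sigma>
        using gp[OF that] real_hom_simps(5)[OF F(1) that(1) gF] by simp
      then show ?thesis unfolding v by (intro exI[of _ 1] exI[of _ "-1"]) auto
    next
      case 3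
      then have "\<sigma> a = 1 * golden" if "real_hom F \<sigma>" "\<sigma> (sqrt 5) = -1 * sqrt 5" for \<sigma>
        using gm[OF that] real_hom_simps(6)[OF F(1) that(1) c(2) gF] real_hom_simps(2)[OF F(1) that(1)] by simp
      then show ?thesis unfolding v by (intro exI[of _ "-1"] exI[of _ 1]) auto
    next
      case 4
      then have "\<sigma> a = -1 * golden" if "real_hom F \<sigma>" "\<sigma> (sqrt 5) = -1 * sqrt 5" for \<sigma>
        using gm[OF that] real_hom_simps(6)[OF F(1) that(1) gF c(2)] real_hom_simps(2)[OF F(1) that(1)] by simp
      then show ?thesis unfolding v by (intro exI[of _ "-1"] exI[of _ "-1"]) auto
    qed
  qed
qed

text \<open>Distinct types cannot both be 5, so one entry has a free sign, used to give the product
  the sign \<open>\<tau>\<close>. They cannot both be 2 either, whence the strict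
  inequality.\<close>

lemma irr_type_conjugate:
  assumes ds: "\<forall>d\<in>set ds. d \<ge> 0" and a: "a \<in> irr_type X" and b: "b \<in> irr_type Y" and XY: "X \<noteq> Y"
    and \<tau>: "\<tau> * \<tau> = (1::real)"
  obtains \<sigma> where "real_hom (sqrt_tower (ds @ [5, 3, 2])) \<sigma>" "\<bar>\<sigma> a\<bar> \<ge> sqrt 2" "\<bar>\<sigma> b\<bar> \<ge> sqrt 2"
    "\<bar>\<sigma> a\<bar> > sqrt 2 \<or> \<bar>\<sigma> b\<bar> > sqrt 2" "\<tau> * (\<sigma> a * \<sigma> b) > 0"
proof -
  let ?F = "sqrt_tower (ds @ [5, 3, 2])"
  let ?P = "\<lambda>t a e s. e * e = 1 \<and> s * s = (1::real) \<and>
      (\<forall>\<sigma>. real_hom ?F \<sigma> \<longrightarrow> \<sigma> (sqrt (real t)) = e * sqrt (real t) \<longrightarrow> \<sigma> a = s * irr_val t)"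
  have F: "real_subfield ?F" using ds by (intro real_subfield_sqrt_tower) auto
  have sF: "sqrt (real t) \<in> ?F" if t: "t = 2 \<or> t = 3 \<or> t = 5" for t
  proof -
    have "sqrt (of_int (int t)) \<in> ?F" by (rule sqrt_in_sqrt_tower) (use ds t in auto)
    then show ?thesis by simp
  qed
  note X = irr_type_cases[OF a] and Y = irr_type_cases[OF b]
  note cX = irr_type_conjugate_sign[OF F sF[OF X] a] and cY = irr_type_conjugate_sign[OF F sF[OF Y] b]
  have "\<exists>e s e' s'. ?P X a e s \<and> ?P Y b e' s' \<and> s * s' = \<tau>"
  proof (cases "Y = 5")
    case False
    obtain e s where s: "?P X a e s" using cX(1) by blast
    have "(\<tau> * s) * (\<tau> * s) = 1" using s \<tau> by (simp add: mult_ac)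
    moreover from this obtain e' where "?P Y b e' (\<tau> * s)" using cY(2)[OF False] by blast
    moreover have "s * (\<tau> * s) = \<tau>" using s by (simp add: mult.left_commute)
    ultimately show ?thesis using s by blast
  next
    case True
    then have X5: "X \<noteq> 5" using XY by simp
    obtain e s where s: "?P Y b e s" using cY(1) by blast
    have "(\<tau> * s) * (\<tau> * s) = 1" using s \<tau> by (simp add: mult_ac)
    moreover from this obtain e' where "?P X a e' (\<tau> * s)" using cX(2)[OF X5] by blast
    moreover have "(\<tau> * s) * s = \<tau>" using s by (simp add: mult.assoc)
    ultimately show ?thesis using s by blast
  qed
  then obtain e s e' s' where es: "?P X a e s" "?P Y b e' s'" "s * s' = \<tau>" by blast
  \<comment> \<open>The root that belongs to neither type gets the sign 1.\<close>
  define E where "E = (\<lambda>t. if t = X then e else if t = Y then e' else 1)"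
  have E: "E t * E t = 1" for t unfolding E_def using es by auto
  obtain \<sigma> where \<sigma>: "real_hom ?F \<sigma>" "\<sigma> (sqrt 2) = E 2 * sqrt 2" "\<sigma> (sqrt 3) = E 3 * sqrt 3" "\<sigma> (sqrt 5) = E 5 * sqrt 5"
    using real_hom_signs[OF E[of 2] E[of 3] E[of 5] ds] by blast
  have st: "\<sigma> (sqrt (real t)) = E t * sqrt (real t)" if t: "t = 2 \<or> t = 3 \<or> t = 5" for t
    using t \<sigma> by auto
  have "\<sigma> a = s * irr_val X" using es(1) \<sigma>(1) st[OF X] unfolding E_def by auto
  moreover have "\<sigma> b = s' * irr_val Y" using es(2) \<sigma>(1) st[OF Y] XY unfolding E_def by auto
  moreover have "irr_val X \<ge> sqrt 2 \<and> irr_val Y \<ge> sqrt 2 \<and> (irr_val X > sqrt 2 \<or> irr_val Y > sqrt 2)"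
    using X Y XY irr_val_bounds unfolding irr_val_def by auto
  moreover have "\<bar>s\<bar> = 1" "\<bar>s'\<bar> = 1" using es by (auto simp: square_eq_1_iff)
  moreover have pos: "irr_val X > 0" "irr_val Y > 0" using X Y irr_val_bounds unfolding irr_val_def by auto
  moreover have "0 < \<tau> * (s * irr_val X * (s' * irr_val Y))"
  proof -
    have "\<tau> * (s * irr_val X * (s' * irr_val Y)) = (\<tau> * (s * s')) * (irr_val X * irr_val Y)" by (simp only: mult_ac)
    moreover have "\<tau> * (s * s') = 1" unfolding es(3) by (rule \<tau>)
    ultimately show ?thesis using pos by (metis mult_1 mult_pos_pos)
  qed
  ultimately show ?thesis using that[OF \<sigma>(1)] by (simp add: abs_mult)
qed

lemma irr_type_subset:
  "irr_type 2 \<subseteq> Z_sqrt2" "irr_type 3 \<subseteq> Z_sqrt3" "irr_type 5 \<subseteq> Z_golden"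
proof -
  have s2: "of_int i + of_int j * sqrt 2 \<in> Z_sqrt2" for i j unfolding Z_sqrt2_def by blast
  have s3: "of_int i + of_int j * sqrt 3 \<in> Z_sqrt3" for i j unfolding Z_sqrt3_def by blast
  have g: "of_int i + of_int j * golden \<in> Z_golden" for i j unfolding Z_golden_def by blast
  show "irr_type 2 \<subseteq> Z_sqrt2" using s2[of 0 1] s2[of 0 "-1"] unfolding irr_type_def by auto
  show "irr_type 3 \<subseteq> Z_sqrt3" using s3[of 0 1] s3[of 0 "-1"] unfolding irr_type_def by auto
  show "irr_type 5 \<subseteq> Z_golden" using g[of 0 1] g[of 0 "-1"] g[of 1 "-1"] g[of "-1" 1] unfolding irr_type_def by auto
qed

lemma Ints_subset_quadratic: "\<int> \<subseteq> Z_sqrt2" "\<int> \<subseteq> Z_sqrt3" "\<int> \<subseteq> Z_golden"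
proof -
  have "of_int i + of_int 0 * sqrt 2 \<in> Z_sqrt2" "of_int i + of_int 0 * sqrt 3 \<in> Z_sqrt3" 
    "of_int i + of_int 0 * golden \<in> Z_golden" for i
    unfolding Z_sqrt2_def Z_sqrt3_def Z_golden_def by blast+
  then show "\<int> \<subseteq> Z_sqrt2" "\<int> \<subseteq> Z_sqrt3" "\<int> \<subseteq> Z_golden" by (auto elim!: Ints_cases)
qed

text \<open>A shortest walk between vertices of different type has integral edges, and the irrational entries at its
  ends extend it to a heavy path. The only possible chord joins the two new end
  vertices when the walk has length 1; its sign is then controlled by the choice of \<open>\<sigma>\<close>.\<close>

lemma two_types_impossible:
  fixes A :: "real mat"
  assumes ds: "\<forall>d\<in>set ds. d \<ge> 0"
    and bound: "\<And>\<sigma> u w. real_hom (sqrt_tower (ds @ [5, 3, 2])) \<sigma> \<Longrightarrow>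
      (\<Sum>i<n. \<Sum>j<n. u i * \<sigma> (A $$ (i, j)) * w j) \<le> (\<Sum>i<n. (u i)\<^sup>2) + (\<Sum>i<n. (w i)\<^sup>2)"
    and sym: "\<And>i j. i < n \<Longrightarrow> j < n \<Longrightarrow> A $$ (i, j) = A $$ (j, i)"
    and ent: "\<And>i j. i < n \<Longrightarrow> j < n \<Longrightarrow> A $$ (i, j) \<in> \<int> \<or> (\<exists>t. A $$ (i, j) \<in> irr_type t)"
    and conn: "\<And>i j. i < n \<Longrightarrow> j < n \<Longrightarrow> (\<lambda>u v. u < n \<and> v < n \<and> A $$ (u, v) \<noteq> 0)\<^sup>*\<^sup>* i j"
    and X0: "i0 < n" "j0 < n" "A $$ (i0, j0) \<in> irr_type X0" and Y0: "i1 < n" "j1 < n" "A $$ (i1, j1) \<in> irr_type Y0"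
  shows "X0 = Y0"
proof (rule ccontr)
  assume XY0: "X0 \<noteq> Y0"
  define E where "E = (\<lambda>u v. u < n \<and> v < n \<and> A $$ (u, v) \<noteq> 0)"
  define has_type where "has_type = (\<lambda>i t. i < n \<and> (\<exists>j<n. A $$ (i, j) \<in> irr_type t))"
  \<comment> \<open>Lengths of walks between any two distinct types; length 0 means that one vertex
    carries both.\<close>
  define good where "good = (\<lambda>k. \<exists>X Y u v. X \<noteq> Y \<and> has_type u X \<and> has_type v Y \<and> (E ^^ k) u v)"
  have typ_pair: "has_type i t" "has_type j t" if "i < n" "j < n" "A $$ (i, j) \<in> irr_type t" for i j t
    using that sym[of i j] unfolding has_type_def by metis+
  have "E\<^sup>*\<^sup>* i0 i1" using conn[OF X0(1) Y0(1)] unfolding E_def .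
  then obtain k0 where "(E ^^ k0) i0 i1" using rtranclp_imp_relpowp by metis
  then have "good k0" unfolding good_def using XY0 typ_pair(1)[OF X0] typ_pair(1)[OF Y0] by blast
  define k where "k = (LEAST k. good k)"
  have "good k" unfolding k_def using \<open>good k0\<close> by (rule LeastI)
  have kmin: "k \<le> j" if "X \<noteq> Y" "has_type u X" "has_type v Y" "(E ^^ j) u v" for X Y u v j
    unfolding k_def by (rule Least_le) (use that in \<open>auto simp: good_def\<close>)
  obtain X Y u v where XY: "X \<noteq> Y" "has_type u X" "has_type v Y" "(E ^^ k) u v" using \<open>good k\<close> unfolding good_def by blast
  obtain x where x: "x 0 = u" "x k = v" "\<And>i. i < k \<Longrightarrow> E (x i) (x (Suc i))"
    using XY(4) unfolding relpowp_fun_conv by blast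
  have E1: "(E ^^ 1) a b" if "E a b" for a b using that unfolding relpowp_1 .
  have walk: "(E ^^ (s - r)) (x r) (x s)" if "r \<le> s" "s \<le> k" for r s
    unfolding relpowp_fun_conv by (rule exI[of _ "\<lambda>i. x (r + i)"]) (use that x(3) in auto)
  have xn: "x r < n" if "r \<le> k" for r
    using that x(3)[of "r - 1"] x(1) XY(2) unfolding E_def has_type_def by (cases r) auto
  \<comment> \<open>Otherwise the walk from position \<open>r\<close> to \<open>v\<close> would join
    distinct types in fewer than \<open>k\<close> steps. \<open>T2\<close> is the mirror
    image.\<close>
  have T1: "r = 0" if "has_type (x r) Z" "Z \<noteq> Y" "r \<le> k" for r Z
    using kmin[OF that(2,1) XY(3), of "k - r"] walk[of r k] x(2) that(3) by auto
  have T2: "r = k" if "has_type (x r) Z" "Z \<noteq> X" "r \<le> k" for r Z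
    using kmin[OF that(2)[symmetric] XY(2) that(1), of r] walk[of 0 r] x(1) that(3) by auto
  have shortcut: "k \<le> r + 1 + (k - s)" if "r \<le> k" "s \<le> k" "E (x r) (x s)" for r s
  proof (rule kmin[OF XY(1-3)])
    have "(E ^^ r) u (x r)" using walk[of 0 r] that x(1) by simp
    moreover have "(E ^^ 1) (x r) (x s)" using that by (intro E1)
    moreover have "(E ^^ (k - s)) (x s) v" using walk[of s k] that x(2) by simp
    ultimately show "(E ^^ (r + 1 + (k - s))) u v" unfolding relpowp_add by blast
  qed
  \<comment> \<open>The irrational entry may be diagonal, so \<open>p = u\<close> can occur;
    positions 0 and 1 of the path then coincide, which their different parity permits.\<close>
  obtain p where p: "p < n" "A $$ (u, p) \<in> irr_type X" using XY(2) unfolding has_type_def by blast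
  obtain q where q: "q < n" "A $$ (v, q) \<in> irr_type Y" using XY(3) unfolding has_type_def by blast
  have un: "u < n" "v < n" using XY unfolding has_type_def by auto
  have tp: "has_type p X" and tq: "has_type q Y" using typ_pair(2)[OF un(1) p] typ_pair(2)[OF un(2) q] .
  \<comment> \<open>The added end vertices take positions 0 and \<open>k + 2\<close>, so the walk is
    shifted by one.\<close>
  define y where "y = (\<lambda>r. if r = 0 then p else if r \<le> k + 1 then x (r - 1) else q)"
  have y0: "y 0 = p" "y (Suc (Suc k)) = q" and ys: "\<And>r. r \<le> k \<Longrightarrow> y (Suc r) = x r"
    unfolding y_def by auto
  have yn: "y r < n" for r unfolding y_def using p q xn[of "r - 1"] by auto
  \<comment> \<open>For \<open>k = 1\<close> a chord (p, q) closes a 4-cycle. \<open>\<tau>\<close>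
    records the sign of its two integral edges, and \<open>\<sigma>\<close> gives the two irrational
    edges a product of that sign, so that the chord contributes nonnegatively after
    switching.\<close>
  define \<tau> :: real where "\<tau> = (if A $$ (x 0, x 1) * A $$ (p, q) < 0 then -1 else 1)"
  have "\<tau> * \<tau> = 1" unfolding \<tau>_def by simp
  then obtain \<sigma> where \<sigma>: "real_hom (sqrt_tower (ds @ [5, 3, 2])) \<sigma>" "\<bar>\<sigma> (A $$ (u, p))\<bar> \<ge> sqrt 2" "\<bar>\<sigma> (A $$ (v, q))\<bar> \<ge> sqrt 2"
    "\<bar>\<sigma> (A $$ (u, p))\<bar> > sqrt 2 \<or> \<bar>\<sigma> (A $$ (v, q))\<bar> > sqrt 2" "\<tau> * (\<sigma> (A $$ (u, p)) * \<sigma> (A $$ (v, q))) > 0"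
    using irr_type_conjugate[OF ds p(2) q(2) XY(1)] by metis
  have F: "real_subfield (sqrt_tower (ds @ [5, 3, 2]))" using ds by (intro real_subfield_sqrt_tower) auto
  define B where "B = (\<lambda>i j. \<sigma> (A $$ (i, j)))"
  have BZ: "B i j = A $$ (i, j)" if "A $$ (i, j) \<in> \<int>" for i j
    using that real_hom_of_int[OF F \<sigma>(1)] unfolding B_def by (auto elim: Ints_cases)
  have B0: "A $$ (i, j) = 0 \<Longrightarrow> B i j = 0" for i j
    using real_hom_simps(1)[OF F \<sigma>(1)] unfolding B_def by simp
  \<comment> \<open>An irrational edge would give its type \<open>Z\<close> to both ends.
    \<open>Z\<close> differs from \<open>X\<close> or from \<open>Y\<close>, contradicting
    \<open>T2\<close> at the left end or \<open>T1\<close> at the right end.\<close>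
  have edge_int: "A $$ (x r, x (Suc r)) \<in> \<int>" if "r < k" for r
  proof (rule ccontr)
    have n: "x r < n" "x (Suc r) < n" using xn that by auto
    assume "A $$ (x r, x (Suc r)) \<notin> \<int>"
    then obtain Z where Z: "A $$ (x r, x (Suc r)) \<in> irr_type Z" using ent[OF n] by blast
    then have "has_type (x r) Z" "has_type (x (Suc r)) Z" using typ_pair[OF n] by auto
    then show False using T1[of "Suc r" Z] T2[of r Z] XY(1) that by auto
  qed
  \<comment> \<open>Otherwise \<open>p\<close> or \<open>q\<close> would carry two distinct types,
    joined by a walk of length 0.\<close>
  have end_int: "A $$ (p, q) \<in> \<int>" if "k \<ge> 1"
  proof (rule ccontr)
    assume "A $$ (p, q) \<notin> \<int>"
    then obtain Z where Z: "A $$ (p, q) \<in> irr_type Z" using ent[OF p(1) q(1)] by blast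
    then have "has_type p Z" "has_type q Z" using typ_pair[OF p(1) q(1)] by auto
    then show False using kmin[of X Z p p 0] kmin[of Z Y q q 0] XY(1) tp tq that by auto
  qed
  show False
  proof (rule no_heavy_path[where B = B and n = n and m = "k + 2" and y = y])
    show "(\<Sum>i<n. \<Sum>j<n. f i * B i j * w j) \<le> (\<Sum>i<n. (f i)\<^sup>2) + (\<Sum>i<n. (w i)\<^sup>2)" for f w
      unfolding B_def by (rule bound[OF \<sigma>(1)])
    show "i < n \<Longrightarrow> j < n \<Longrightarrow> B i j = B j i" for i j unfolding B_def using sym by simp
    show "2 \<le> k + 2" "y r < n" for r using yn by auto
    have f: "B (y 0) (y 1) = \<sigma> (A $$ (u, p))" unfolding B_def using y0 ys[of 0] x(1) sym[OF p(1) un(1)] by simp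
    have l: "B (y (k + 2 - 1)) (y (k + 2)) = \<sigma> (A $$ (v, q))" unfolding B_def using y0 ys[of k] x(2) by simp
    show "sqrt 2 \<le> \<bar>B (y 0) (y 1)\<bar>" "sqrt 2 \<le> \<bar>B (y (k + 2 - 1)) (y (k + 2))\<bar>"
      "\<bar>B (y 0) (y 1)\<bar> > sqrt 2 \<or> \<bar>B (y (k + 2 - 1)) (y (k + 2))\<bar> > sqrt 2"
      unfolding f l by (fact \<sigma>)+
    show "\<bar>B (y r) (y (Suc r))\<bar> \<ge> 1" if "0 < r" "Suc r < k + 2" for r
    proof -
      from that obtain r' where r': "r = Suc r'" "r' < k" by (cases r) auto
      have i: "A $$ (x r', x (Suc r')) \<in> \<int>" using edge_int[OF r'(2)] .
      moreover have "A $$ (x r', x (Suc r')) \<noteq> 0" using x(3)[OF r'(2)] unfolding E_def by simp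
      ultimately have "\<bar>A $$ (x r', x (Suc r'))\<bar> \<ge> 1" by (rule Ints_nonzero_abs_ge1)
      then show ?thesis using BZ[OF i] r' ys by simp
    qed
    show "y r \<noteq> y s" if rs: "r < s" "s \<le> k + 2" "even (s - r)" for r s
    proof
      assume eq: "y r = y s"
      show False
      proof (cases "r = 0"; cases "s = k + 2")
        assume c: "r = 0" "s = k + 2"
        then have "p = q" using eq y0 by simp
        then have "k = 0" using kmin[OF XY(1) tp, of q 0] tq by simp
        then have "A $$ (u, p) \<in> irr_type Y" using q x \<open>p = q\<close> by simp
        then show False using irr_type_disjoint[OF p(2)] XY(1) by blast
      next
        assume c: "r = 0" "s \<noteq> k + 2"
        then obtain s' where s': "s = Suc s'" "s' \<le> k" using rs by (cases s) auto
        then have "has_type (x s') X" using eq c y0 ys[of s'] tp by simp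
        then have "s' = 0" using T1[of s' X] XY(1) s' by simp
        then show False using rs c s' by simp
      next
        assume c: "r \<noteq> 0" "s = k + 2"
        then obtain r' where r': "r = Suc r'" "r' \<le> k" using rs by (cases r) auto
        then have "has_type (x r') Y" using eq c y0 ys[of r'] tq by simp
        then have "r' = k" using T2[of r' Y] XY(1) r' by simp
        then show False using rs c r' by simp
      next
        assume c: "r \<noteq> 0" "s \<noteq> k + 2"
        then obtain r' s' where r': "r = Suc r'" "s = Suc s'" "r' < s'" "s' \<le> k" 
          using rs by (cases r; cases s) auto
        then have "x r' = x s'" using eq ys by simp
        then have "(E ^^ r') u (x r')" "(E ^^ (k - s')) (x r') v" using walk[of 0 r'] walk[of s' k] x r' by auto
        then have "(E ^^ (r' + (k - s'))) u v" unfolding relpowp_add by blast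
        then have "k \<le> r' + (k - s')" by (rule kmin[OF XY(1-3)])
        then show False using r' by linarith
      qed
    qed
    show "path_sign B y r * path_sign B y s * B (y r) (y s) \<ge> 0"
      if rs: "r < s" "s \<le> k + 2" "odd (s - r)" "Suc r \<noteq> s" for r s
    proof (cases "A $$ (y r, y s) = 0")
      case True
      then show ?thesis using B0 by simp
    next
      case False
      then have Ers: "E (y r) (y s)" unfolding E_def using yn by simp
      \<comment> \<open>An odd span other than 1 is at least 3. Then any chord except (p, q) yields
        a walk shorter than \<open>k\<close> between distinct types.\<close>
      have s3: "s \<ge> r + 3" 
      proof -
        have "s - r \<noteq> 2" using rs(3) by (metis dvd_refl)
        then show ?thesis using rs by linarith
      qed
      show ?thesis
      proof (cases "r = 0"; cases "s = k + 2")
        assume c: "r = 0" "s = k + 2"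
        then have "E p q" using Ers y0 by simp
        then have "(E ^^ 1) p q" by (rule E1)
        then have "k \<le> 1" by (rule kmin[OF XY(1) tp tq])
        then have k1: "k = 1" using rs(3) c by (cases "k = 0") auto
        have y: "y 0 = p" "y (Suc 0) = u" "y (Suc (Suc 0)) = v" "y (Suc (Suc (Suc 0))) = q"
          using y0 ys[of 0] ys[of 1] k1 x by auto
        have s: "r = 0" "s = Suc (Suc (Suc 0))" using c k1 by auto
        have e: "B u v = A $$ (u, v)" "B p q = A $$ (p, q)"
          using BZ edge_int[of 0] end_int k1 x by auto
        have Bp: "B p u = \<sigma> (A $$ (u, p))" "B v q = \<sigma> (A $$ (v, q))" unfolding B_def using sym p un by auto
        have t: "\<tau> * (A $$ (u, v) * A $$ (p, q)) \<ge> 0" 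
          unfolding \<tau>_def using x k1 by auto
        have "(sgn (B p u) * sgn (B u v) * sgn (B v q)) * B p q 
            = sgn (B p u * B v q) * (sgn (A $$ (u, v)) * A $$ (p, q))" unfolding e by (simp add: sgn_mult)
        also have "sgn (B p u * B v q) = \<tau>"
          using \<sigma>(5) unfolding Bp \<tau>_def by (auto split: if_splits)
        also have "\<tau> * (sgn (A $$ (u, v)) * A $$ (p, q)) \<ge> 0" 
          using t by (auto simp: sgn_if zero_le_mult_iff mult_le_0_iff split: if_splits)
        finally show ?thesis unfolding s path_sign.simps y by simp
      next
        assume c: "r = 0" "s \<noteq> k + 2"
        then obtain s' where s': "s = Suc s'" "s' \<le> k" using rs by (cases s) auto
        then have "(E ^^ 1) p (x s')" using Ers c y0 ys by (intro E1) simp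
        moreover have "(E ^^ (k - s')) (x s') v" using walk[of s' k] s' x(2) by simp
        ultimately have "(E ^^ (1 + (k - s'))) p v" unfolding relpowp_add by blast
        then have "k \<le> 1 + (k - s')" by (rule kmin[OF XY(1) tp XY(3)])
        then show ?thesis using s3 s' c by linarith
      next
        assume c: "r \<noteq> 0" "s = k + 2"
        then obtain r' where r': "r = Suc r'" "r' \<le> k" using rs by (cases r) auto
        then have "(E ^^ 1) (x r') q" using Ers c y0 ys by (intro E1) simp
        moreover have "(E ^^ r') u (x r')" using walk[of 0 r'] r' x(1) by simp
        ultimately have "(E ^^ (r' + 1)) u q" unfolding relpowp_add by blast
        then have "k \<le> r' + 1" by (rule kmin[OF XY(1,2) tq])
        then show ?thesis using s3 r' c by linarith
      next
        assume c: "r \<noteq> 0" "s \<noteq> k + 2"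
        then obtain r' s' where r': "r = Suc r'" "s = Suc s'" "r' < s'" "s' \<le> k" 
          using rs by (cases r; cases s) auto
        then have "E (x r') (x s')" using Ers ys by simp
        then have "k \<le> r' + 1 + (k - s')" using shortcut[of r' s'] r' by simp
        then show ?thesis using s3 r' by linarith
      qed
    qed
  qed
qed

theorem theorem8:
  fixes A :: "real mat" and n :: nat
  assumes "A \<in> carrier_mat n n"
    and "\<forall>i < n. \<forall>j < n. A $$ (i, j) \<in> quad_compositum"
    and "cyclotomic_mat A"
    and "indecomposable A"
  shows "\<exists>S \<in> {\<int>, Z_sqrt2, Z_golden, Z_sqrt3}. \<forall>i < n. \<forall>j < n. A $$ (i, j) \<in> S"
proof -
  define X where "X = (\<lambda>(i, j). A $$ (i, j)) ` ({..<n} \<times> {..<n})"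
  have X: "A $$ (i, j) \<in> X" if "i < n" "j < n" for i j
    unfolding X_def using that by (intro image_eqI[of _ _ "(i, j)"]) auto
  have "finite X" "X \<subseteq> quad_compositum" unfolding X_def using assms(2) by auto
  then obtain ds where ds: "\<forall>d\<in>set ds. d \<ge> 0" "X \<subseteq> sqrt_tower ds"
    using finite_quad_compositum_in_sqrt_tower by metis
  \<comment> \<open>The roots of 2, 3 and 5 are always included, so that their signs can be chosen
    by \<open>real_hom_signs\<close> in the very field used for the classification.\<close>
  define F where "F = sqrt_tower (ds @ [5, 3, 2])"
  have nn: "\<forall>d\<in>set (ds @ [5, 3, 2]). d \<ge> 0" using ds by simp
  have F: "real_subfield F" "norm_separated F"
    unfolding F_def by (intro real_subfield_sqrt_tower norm_separated_sqrt_tower nn)+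
  have e: "A $$ (i, j) \<in> F" if "i < n" "j < n" for i j
    using X[OF that] ds(2) sqrt_tower_mono[OF nn, of ds] unfolding F_def by auto
  have bound: "(\<Sum>i<n. \<Sum>j<n. u i * \<sigma> (A $$ (i, j)) * w j) \<le> (\<Sum>i<n. (u i)\<^sup>2) + (\<Sum>i<n. (w i)\<^sup>2)"
    if \<sigma>: "real_hom F \<sigma>" for \<sigma> u w
  proof -
    have "(\<Sum>i<n. \<Sum>j<n. u i * map_mat \<sigma> A $$ (i, j) * w j) \<le> (\<Sum>i<n. (u i)\<^sup>2) + (\<Sum>i<n. (w i)\<^sup>2)"
      by (rule cyclotomic_bilinear_bound[OF _ cyclotomic_mat_real_hom[OF F(1) \<sigma> assms(1) e assms(3)]]) (use assms(1) in auto)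
    then show ?thesis using assms(1) by simp
  qed
  have le2: "\<bar>\<sigma> (A $$ (i, j))\<bar> \<le> 2" if \<sigma>: "real_hom F \<sigma>" and ij: "i < n" "j < n" for \<sigma> i j
  proof -
    have "s * \<sigma> (A $$ (i, j)) \<le> 2" if s: "s * s = 1" for s
    proof -
      \<comment> \<open>A signed unit vector and a unit vector: the right-hand side of the bilinear
        bound becomes 1 + 1.\<close>
      define u w :: "nat \<Rightarrow> real" where "u = (\<lambda>k. if k = i then s else 0)" and "w = (\<lambda>k. if k = j then 1 else 0)"
      have "(\<Sum>a<n. \<Sum>b<n. u a * \<sigma> (A $$ (a, b)) * w b) = (\<Sum>a<n. u a * \<sigma> (A $$ (a, j)))"
        by (intro sum.cong refl) (use ij in \<open>simp add: w_def if_distrib cong: if_cong\<close>)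
      also have "\<dots> = (\<Sum>a<n. if a = i then s * \<sigma> (A $$ (a, j)) else 0)" unfolding u_def by (intro sum.cong) auto
      also have "\<dots> = s * \<sigma> (A $$ (i, j))" using ij by simp
      finally have 1: "(\<Sum>a<n. \<Sum>b<n. u a * \<sigma> (A $$ (a, b)) * w b) = s * \<sigma> (A $$ (i, j))" .
      have "(\<Sum>a<n. (u a)\<^sup>2) = (\<Sum>a<n. if a = i then 1 else 0)"
        unfolding u_def using s by (intro sum.cong) (auto simp: power2_eq_square)
      moreover have "(\<Sum>a<n. (w a)\<^sup>2) = (\<Sum>a<n. if a = j then 1 else 0)"
        unfolding w_def by (intro sum.cong) auto
      ultimately show ?thesis using bound[OF \<sigma>, of u w] ij unfolding 1 by simp
    qed
    from this[of 1] this[of "-1"] show ?thesis by simp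
  qed
  have ent: "A $$ (i, j) \<in> \<int> \<or> (\<exists>t. A $$ (i, j) \<in> irr_type t)" if ij: "i < n" "j < n" for i j
  proof -
    have "A $$ (i, j) \<in> {0, 1, -1, 2, -2, sqrt 2, - sqrt 2, sqrt 3, - sqrt 3, golden, - golden, 1 - golden, golden - 1}"
      by (rule cyclotomic_entry_classification[OF F e[OF ij]]) (use assms(2) ij le2 in auto)
    moreover have "irr_type 2 = {sqrt 2, - sqrt 2}" "irr_type 3 = {sqrt 3, - sqrt 3}"
      "irr_type 5 = {golden, - golden, 1 - golden, golden - 1}" unfolding irr_type_def by auto
    ultimately have "A $$ (i, j) \<in> \<int> \<or> A $$ (i, j) \<in> irr_type 2 \<or> A $$ (i, j) \<in> irr_type 3 \<or> A $$ (i, j) \<in> irr_type 5"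
      by auto
    then show ?thesis by blast
  qed
  have sym: "A $$ (i, j) = A $$ (j, i)" if "i < n" "j < n" for i j
    using assms(1,3) that index_transpose_mat(1)[of j A i] unfolding cyclotomic_mat_def by auto
  have conn: "(\<lambda>u v. u < n \<and> v < n \<and> A $$ (u, v) \<noteq> 0)\<^sup>*\<^sup>* i j" if "i < n" "j < n" for i j
    by (rule rtranclp_mono[THEN predicate2D, of "mat_adj A"])
      (use assms(1,4) that in \<open>auto simp: indecomposable_def mat_adj_def\<close>)
  show ?thesis
  proof (cases "\<exists>i<n. \<exists>j<n. \<exists>t. A $$ (i, j) \<in> irr_type t")
    case False
    then have "\<forall>i<n. \<forall>j<n. A $$ (i, j) \<in> \<int>" using ent by metis
    then show ?thesis by (rule bexI) simp
  next
    case True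
    then obtain i0 j0 t where t: "i0 < n" "j0 < n" "A $$ (i0, j0) \<in> irr_type t" by blast
    have one: "A $$ (i, j) \<in> \<int> \<union> irr_type t" if ij: "i < n" "j < n" for i j
    proof (cases "A $$ (i, j) \<in> \<int>")
      case False
      then obtain t' where t': "A $$ (i, j) \<in> irr_type t'" using ent[OF ij] by metis
      have "t = t'" by (rule two_types_impossible[OF ds(1) bound[unfolded F_def] sym ent conn t ij t'])
      then show ?thesis using t' by simp
    qed simp
    have "t = 2 \<or> t = 3 \<or> t = 5" by (rule irr_type_cases[OF t(3)])
    then obtain S where S: "S \<in> {\<int>, Z_sqrt2, Z_golden, Z_sqrt3}" "\<int> \<union> irr_type t \<subseteq> S"
    proof (elim disjE)
      assume "t = 2"
      then show ?thesis using that[of Z_sqrt2] irr_type_subset(1) Ints_subset_quadratic(1) by simp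
    next
      assume "t = 3"
      then show ?thesis using that[of Z_sqrt3] irr_type_subset(2) Ints_subset_quadratic(2) by simp
    next
      assume "t = 5"
      then show ?thesis using that[of Z_golden] irr_type_subset(3) Ints_subset_quadratic(3) by simp
    qed
    have "\<forall>i<n. \<forall>j<n. A $$ (i, j) \<in> S" using one S(2) by blast
    then show ?thesis using S(1) by (rule bexI)
  qed
qed

end
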